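(* Let $\mathcal{K}$ be a category whose objects are posets $\mathcal{C}$, each equipped with a subcanonical Grothendieck topology $J_{\mathcal{C}}$, and whose arrows are (certain) monotone maps such that every arrow $\mathcal{C}\to\mathcal{D}$ of $\mathcal{K}$ is a morphism of sites $(\mathcal{C},J_{\mathcal{C}})\to(\mathcal{D},J_{\mathcal{D}})$. Let $A:\mathcal{K}^{\mathrm{op}}\to\mathbf{Loc}$ be the functor sending $\mathcal{C}$ to the locale $\mathrm{Id}_{J_{\mathcal{C}}}(\mathcal{C})$ and $f:\mathcal{C}\to\mathcal{D}$ to the locale morphism whose frame homomorphism $\mathrm{Id}_{J_{\mathcal{C}}}(\mathcal{C})\to\mathrm{Id}_{J_{\mathcal{D}}}(\mathcal{D})$ sends $I$ to the smallest $J_{\mathcal{D}}$-ideal containing $f(I)$; assume that $A$ creates isomorphisms. Let $C$ be an invariant property of families of elements of frames such that for any $\mathcal{C}$ in $\mathcal{K}$ and any family $\mathcal{F}$ of principal $J_{\mathcal{C}}$-ideals on $\mathcal{C}$, $\mathcal{F}$ has a refinement in $\mathrm{Id}_{J_{\mathcal{C}}}(\mathcal{C})$ satisfying $C$ if and only if it has a refinement satisfying $C$ made of principal $J_{\mathcal{C}}$-ideals. If all the Grothendieck topologies $J_{\mathcal{C}}$ associated to the structures in $\mathcal{K}$ are $C$-induced, then the functor $A$, regarded as a functor $\mathcal{K}^{\mathrm{op}}\to \mathrm{ExtIm}(A)$ onto its extended image, admits a categorical inverse $I_A:\mathrm{ExtIm}(A)\to\mathcal{K}^{\mathrm{op}}$,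 sending a locale $L$ in $\mathrm{ExtIm}(A)$ to the poset of $C$-compact elements of $L$ and a locale morphism $L\to L'$ in $\mathrm{ExtIm}(A)$ to the restriction of its associated frame homomorphism to the subsets of $C$-compact elements of $L'$ and $L$.
   Context: Posets are regarded as categories. A $J$-ideal on $\mathcal{C}$ is a lower set $I$ such that whenever all elements of a $J$-covering sieve on $c$ lie in $I$, also $c\in I$; $\mathrm{Id}_J(\mathcal{C})$ is the frame of $J$-ideals ordered by inclusion. The principal $J$-ideal of $c$ is the smallest $J$-ideal containing $c$; for $J$ subcanonical it is $\{d\mid d\le c\}$. $J$ is subcanonical if each $c$ is the supremum of every $J$-covering sieve on it. A morphism of sites between posets is a monotone map $f:\mathcal{C}\to\mathcal{D}$ such that: for every $d\in\mathcal{D}$ there is $c$ with $d\le f(c)$; whenever $d\le f(c),f(c')$ there is $c''\le c,c'$ with $d\le f(c'')$; and the image of any $J_{\mathcal{C}}$-covering sieve generates a $J_{\mathcal{D}}$-covering sieve. A functor $F$ creates isomorphisms if for any isomorphism $l:F(c)\cong F(d)$ there is an isomorphism $u:c\cong d$ with $F(u)=l$. For such $F:\mathcal{A}\to\mathcal{B}$, the extended image $\mathrm{ExtIm}(F)$ is the subcategory of $\mathcal{B}$ whose objects are those isomorphic to some $F(c)$ and whose arrows are the $f:x\to y$ for which there are an arrow $u:c\to c'$ of $\mathcal{A}$ and isomorphisms $x\cong F(c)$, $y\cong F(c')$ through which $f$ corresponds to $F(u)$. A family $\{b_j\}$ of elements of a frame refines a family $\{a_i\}$ if each $b_j\le a_i$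 for some $i$ and $\bigvee_j b_j=\bigvee_i a_i$. An invariant property $C$ of families of elements of frames is a property of families of elements of a frame stable under frame isomorphism (equivalently, a topos-theoretic invariant property of families of subterminal objects in locally small cocomplete toposes). An element $l$ of a frame $L$ is $C$-compact if every family of elements of $L$ with join $l$ has a refinement satisfying $C$. Let $P$ be an invariant property of embeddings $B_L\hookrightarrow L$ of a basis $B_L$ of a frame $L$ (a subset such that each element of $L$ is a join of elements of it) which holds for all the canonical embeddings $\mathcal{C}\hookrightarrow \mathrm{Id}_{J_{\mathcal{C}}}(\mathcal{C})$, $c\mapsto \{d\mid d\le c\}$, for $\mathcal{C}$ in $\mathcal{K}$. The topology $J_{\mathcal{C}}$ is $C$-induced relative to $P$ if for every frame $L$ and every monotone embedding $i:\mathcal{C}\hookrightarrow L$ whose image is a basis of $L$, which satisfies $P$ and sends $J_{\mathcal{C}}$-covering sieves to covering families in $L$ (i.e. $i(c)=\bigvee_{d\in S}i(d)$ for each $J_{\mathcal{C}}$-covering sieve $S$ on $c$), the following holds for every family $\mathcal{A}$ of elements of $\mathcal{C}$: there exists $c\in\mathcal{C}$ with $a\le c$ for all $a\in\mathcal{A}$ such that the sieve on $c$ generated by $\mathcal{A}$ is $J_{\mathcal{C}}$-covering if and only if the family $i(\mathcal{A})$ in $L$ has a refinement satisfying $C$ made of elements of the form $i(c')$ with $c'\in\mathcal{C}$. $J_{\mathcal{C}}$ is $C$-induced if it is $C$-induced relative to some such $P$. *)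

theory Defs
  imports "HOL-Algebra.Complete_Lattice" "HOL-Library.FuncSet"
begin

text \<open>
  Categories are given by hom-sets which need not be disjoint: the same raw arrow (typically a
  function) may occur in several hom-sets, so domains and codomains are passed explicitly.
  \<open>Comp \<X> X Y Z g f\<close> is the composite of \<open>f : X \<rightarrow> Y\<close> followed by \<open>g : Y \<rightarrow> Z\<close>.
\<close>

record ('o, 'm) cat =
  Ob :: "'o set"
  Hom :: "'o \<Rightarrow> 'o \<Rightarrow> 'm set"
  Ident :: "'o \<Rightarrow> 'm"
  Comp :: "'o \<Rightarrow> 'o \<Rightarrow> 'o \<Rightarrow> 'm \<Rightarrow> 'm \<Rightarrow> 'm"

locale category =
  fixes \<X> :: "('o, 'm) cat"
  assumes Ident_in_Hom: "X \<in> Ob \<X> \<Longrightarrow> Ident \<X> X \<in> Hom \<X> X X"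
    and Comp_in_Hom: "\<lbrakk>X \<in> Ob \<X>; Y \<in> Ob \<X>; Z \<in> Ob \<X>; f \<in> Hom \<X> X Y; g \<in> Hom \<X> Y Z\<rbrakk>
      \<Longrightarrow> Comp \<X> X Y Z g f \<in> Hom \<X> X Z"
    and Comp_Ident_right: "\<lbrakk>X \<in> Ob \<X>; Y \<in> Ob \<X>; f \<in> Hom \<X> X Y\<rbrakk>
      \<Longrightarrow> Comp \<X> X X Y f (Ident \<X> X) = f"
    and Comp_Ident_left: "\<lbrakk>X \<in> Ob \<X>; Y \<in> Ob \<X>; f \<in> Hom \<X> X Y\<rbrakk>
      \<Longrightarrow> Comp \<X> X Y Y (Ident \<X> Y) f = f"
    and Comp_assoc: "\<lbrakk>W \<in> Ob \<X>; X \<in> Ob \<X>; Y \<in> Ob \<X>; Z \<in> Ob \<X>;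
        f \<in> Hom \<X> W X; g \<in> Hom \<X> X Y; h \<in> Hom \<X> Y Z\<rbrakk>
      \<Longrightarrow> Comp \<X> W X Z (Comp \<X> X Y Z h g) f = Comp \<X> W Y Z h (Comp \<X> W X Y g f)"

definition op_cat :: "('o, 'm) cat \<Rightarrow> ('o, 'm) cat" where
  "op_cat \<X> = \<lparr>Ob = Ob \<X>, Hom = (\<lambda>X Y. Hom \<X> Y X), Ident = Ident \<X>,
     Comp = (\<lambda>X Y Z g f. Comp \<X> Z Y X f g)\<rparr>"

definition is_iso :: "('o, 'm) cat \<Rightarrow> 'o \<Rightarrow> 'o \<Rightarrow> 'm \<Rightarrow> bool" where
  "is_iso \<X> X Y f \<longleftrightarrow> f \<in> Hom \<X> X Y \<and>
     (\<exists>g \<in> Hom \<X> Y X. Comp \<X> X Y X g f = Ident \<X> X \<and> Comp \<X> Y X Y f g = Ident \<X> Y)"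

record ('o, 'm, 'p, 'n) func =
  on_ob :: "'o \<Rightarrow> 'p"
  on_arr :: "'o \<Rightarrow> 'o \<Rightarrow> 'm \<Rightarrow> 'n"

definition is_functor :: "('o, 'm) cat \<Rightarrow> ('p, 'n) cat \<Rightarrow> ('o, 'm, 'p, 'n) func \<Rightarrow> bool" where
  "is_functor \<X> \<Y> F \<longleftrightarrow> category \<X> \<and> category \<Y> \<and>
     (\<forall>X \<in> Ob \<X>. on_ob F X \<in> Ob \<Y>) \<and>
     (\<forall>X \<in> Ob \<X>. \<forall>Y \<in> Ob \<X>. \<forall>f \<in> Hom \<X> X Y.
        on_arr F X Y f \<in> Hom \<Y> (on_ob F X) (on_ob F Y)) \<and>
     (\<forall>X \<in> Ob \<X>. on_arr F X X (Ident \<X> X) = Ident \<Y> (on_ob F X)) \<and>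
     (\<forall>X \<in> Ob \<X>. \<forall>Y \<in> Ob \<X>. \<forall>Z \<in> Ob \<X>. \<forall>f \<in> Hom \<X> X Y. \<forall>g \<in> Hom \<X> Y Z.
        on_arr F X Z (Comp \<X> X Y Z g f) =
        Comp \<Y> (on_ob F X) (on_ob F Y) (on_ob F Z) (on_arr F Y Z g) (on_arr F X Y f))"

definition id_func :: "('o, 'm, 'o, 'm) func" where
  "id_func = \<lparr>on_ob = (\<lambda>X. X), on_arr = (\<lambda>X Y f. f)\<rparr>"

definition comp_func ::
  "('p, 'n, 'q, 'k) func \<Rightarrow> ('o, 'm, 'p, 'n) func \<Rightarrow> ('o, 'm, 'q, 'k) func" where
  "comp_func G F = \<lparr>on_ob = (\<lambda>X. on_ob G (on_ob F X)),
     on_arr = (\<lambda>X Y f. on_arr G (on_ob F X) (on_ob F Y) (on_arr F X Y f))\<rparr>"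

definition naturally_isomorphic ::
  "('o, 'm) cat \<Rightarrow> ('p, 'n) cat \<Rightarrow> ('o, 'm, 'p, 'n) func \<Rightarrow> ('o, 'm, 'p, 'n) func \<Rightarrow> bool" where
  "naturally_isomorphic \<X> \<Y> F G \<longleftrightarrow>
     (\<exists>\<eta>. (\<forall>X \<in> Ob \<X>. is_iso \<Y> (on_ob F X) (on_ob G X) (\<eta> X)) \<and>
        (\<forall>X \<in> Ob \<X>. \<forall>Y \<in> Ob \<X>. \<forall>f \<in> Hom \<X> X Y.
           Comp \<Y> (on_ob F X) (on_ob F Y) (on_ob G Y) (\<eta> Y) (on_arr F X Y f) =
           Comp \<Y> (on_ob F X) (on_ob G X) (on_ob G Y) (on_arr G X Y f) (\<eta> X)))"

definition categorical_inverse ::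
  "('o, 'm) cat \<Rightarrow> ('p, 'n) cat \<Rightarrow> ('o, 'm, 'p, 'n) func \<Rightarrow> ('p, 'n, 'o, 'm) func \<Rightarrow> bool" where
  "categorical_inverse \<X> \<Y> F G \<longleftrightarrow> is_functor \<X> \<Y> F \<and> is_functor \<Y> \<X> G \<and>
     naturally_isomorphic \<X> \<X> id_func (comp_func G F) \<and>
     naturally_isomorphic \<Y> \<Y> (comp_func F G) id_func"

definition creates_isos ::
  "('o, 'm) cat \<Rightarrow> ('p, 'n) cat \<Rightarrow> ('o, 'm, 'p, 'n) func \<Rightarrow> bool" where
  "creates_isos \<X> \<Y> F \<longleftrightarrow>
     (\<forall>X \<in> Ob \<X>. \<forall>Y \<in> Ob \<X>. \<forall>l. is_iso \<Y> (on_ob F X) (on_ob F Y) l \<longrightarrow>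
        (\<exists>u. is_iso \<X> X Y u \<and> on_arr F X Y u = l))"

definition ExtIm ::
  "('o, 'm) cat \<Rightarrow> ('p, 'n) cat \<Rightarrow> ('o, 'm, 'p, 'n) func \<Rightarrow> ('p, 'n) cat" where
  "ExtIm \<X> \<Y> F = \<lparr>
     Ob = {x \<in> Ob \<Y>. \<exists>X \<in> Ob \<X>. \<exists>\<alpha>. is_iso \<Y> x (on_ob F X) \<alpha>},
     Hom = (\<lambda>x y. {f \<in> Hom \<Y> x y. \<exists>X \<in> Ob \<X>. \<exists>Y \<in> Ob \<X>. \<exists>u \<in> Hom \<X> X Y. \<exists>\<alpha> \<beta>.
        is_iso \<Y> x (on_ob F X) \<alpha> \<and> is_iso \<Y> y (on_ob F Y) \<beta> \<and>
        Comp \<Y> x y (on_ob F Y) \<beta> f = Comp \<Y> x (on_ob F X) (on_ob F Y) (on_arr F X Y u) \<alpha>}),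
     Ident = Ident \<Y>,
     Comp = Comp \<Y>\<rparr>"

definition order_iso ::
  "('a, 'c) gorder_scheme \<Rightarrow> ('b, 'd) gorder_scheme \<Rightarrow> ('a \<Rightarrow> 'b) \<Rightarrow> bool" where
  "order_iso P Q f \<longleftrightarrow> bij_betw f (carrier P) (carrier Q) \<and>
     (\<forall>x \<in> carrier P. \<forall>y \<in> carrier P. x \<sqsubseteq>\<^bsub>P\<^esub> y \<longleftrightarrow> f x \<sqsubseteq>\<^bsub>Q\<^esub> f y)"

definition frame :: "'l gorder \<Rightarrow> bool" where
  "frame L \<longleftrightarrow> complete_lattice L \<and>
     (\<forall>x \<in> carrier L. \<forall>A. A \<subseteq> carrier L \<longrightarrow>
        x \<sqinter>\<^bsub>L\<^esub> (\<Squnion>\<^bsub>L\<^esub> A) = \<Squnion>\<^bsub>L\<^esub> ((\<lambda>a. x \<sqinter>\<^bsub>L\<^esub> a) ` A))"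

definition frame_homs :: "'l gorder \<Rightarrow> 'l gorder \<Rightarrow> ('l \<Rightarrow> 'l) set" where
  "frame_homs L M = {f \<in> carrier L \<rightarrow>\<^sub>E carrier M.
     (\<forall>A. A \<subseteq> carrier L \<longrightarrow> f (\<Squnion>\<^bsub>L\<^esub> A) = \<Squnion>\<^bsub>M\<^esub> (f ` A)) \<and>
     f \<top>\<^bsub>L\<^esub> = \<top>\<^bsub>M\<^esub> \<and>
     (\<forall>x \<in> carrier L. \<forall>y \<in> carrier L. f (x \<sqinter>\<^bsub>L\<^esub> y) = f x \<sqinter>\<^bsub>M\<^esub> f y)}"

definition Frm :: "('l gorder, 'l \<Rightarrow> 'l) cat" where
  "Frm = \<lparr>Ob = {L. frame L}, Hom = frame_homs, Ident = (\<lambda>L. \<lambda>x\<in>carrier L. x),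
     Comp = (\<lambda>L M N g f. compose (carrier L) g f)\<rparr>"

text \<open>An arrow \<open>L \<rightarrow> L'\<close> of \<open>Loc\<close> is represented by its associated frame homomorphism \<open>L' \<rightarrow> L\<close>.\<close>

definition Loc :: "('l gorder, 'l \<Rightarrow> 'l) cat" where
  "Loc = op_cat Frm"

definition frame_basis :: "'l gorder \<Rightarrow> 'l set \<Rightarrow> bool" where
  "frame_basis L B \<longleftrightarrow> B \<subseteq> carrier L \<and> (\<forall>l \<in> carrier L. \<exists>S. S \<subseteq> B \<and> \<Squnion>\<^bsub>L\<^esub> S = l)"

record 'a site = "'a gorder" +
  covers :: "'a \<Rightarrow> 'a set set"

definition down :: "('a, 'c) gorder_scheme \<Rightarrow> 'a \<Rightarrow> 'a set" where
  "down X c = {d \<in> carrier X. d \<sqsubseteq>\<^bsub>X\<^esub> c}"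

definition is_sieve :: "('a, 'c) gorder_scheme \<Rightarrow> 'a \<Rightarrow> 'a set \<Rightarrow> bool" where
  "is_sieve X c S \<longleftrightarrow> S \<subseteq> down X c \<and> (\<forall>s \<in> S. \<forall>d \<in> carrier X. d \<sqsubseteq>\<^bsub>X\<^esub> s \<longrightarrow> d \<in> S)"

text \<open>The downward closure of \<open>A\<close>; it is the sieve on \<open>c\<close> generated by \<open>A\<close> whenever \<open>A\<close> lies
  below \<open>c\<close>.\<close>

definition generated_sieve :: "('a, 'c) gorder_scheme \<Rightarrow> 'a set \<Rightarrow> 'a set" where
  "generated_sieve X A = {d \<in> carrier X. \<exists>a \<in> A. d \<sqsubseteq>\<^bsub>X\<^esub> a}"

text \<open>The pullback of a sieve \<open>S\<close> along \<open>d \<le> c\<close> is \<open>S \<inter> down X d\<close>.\<close>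

definition grothendieck_topology :: "'a site \<Rightarrow> bool" where
  "grothendieck_topology X \<longleftrightarrow>
     (\<forall>c \<in> carrier X. \<forall>S \<in> covers X c. is_sieve X c S) \<and>
     (\<forall>c \<in> carrier X. down X c \<in> covers X c) \<and>
     (\<forall>c \<in> carrier X. \<forall>S \<in> covers X c. \<forall>d \<in> down X c. S \<inter> down X d \<in> covers X d) \<and>
     (\<forall>c \<in> carrier X. \<forall>S \<in> covers X c. \<forall>R. is_sieve X c R \<longrightarrow>
        (\<forall>d \<in> S. R \<inter> down X d \<in> covers X d) \<longrightarrow> R \<in> covers X c)"

definition subcanonical :: "'a site \<Rightarrow> bool" where
  "subcanonical X \<longleftrightarrow> (\<forall>c \<in> carrier X. \<forall>S \<in> covers X c. is_lub X c S)"

definition site_morphism :: "'a site \<Rightarrow> 'b site \<Rightarrow> ('a \<Rightarrow> 'b) \<Rightarrow> bool" where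
  "site_morphism X Y f \<longleftrightarrow> isotone X Y f \<and> f \<in> carrier X \<rightarrow> carrier Y \<and>
     (\<forall>d \<in> carrier Y. \<exists>c \<in> carrier X. d \<sqsubseteq>\<^bsub>Y\<^esub> f c) \<and>
     (\<forall>d \<in> carrier Y. \<forall>c \<in> carrier X. \<forall>c' \<in> carrier X.
        d \<sqsubseteq>\<^bsub>Y\<^esub> f c \<longrightarrow> d \<sqsubseteq>\<^bsub>Y\<^esub> f c' \<longrightarrow>
        (\<exists>c'' \<in> carrier X. c'' \<sqsubseteq>\<^bsub>X\<^esub> c \<and> c'' \<sqsubseteq>\<^bsub>X\<^esub> c' \<and> d \<sqsubseteq>\<^bsub>Y\<^esub> f c'')) \<and>
     (\<forall>c \<in> carrier X. \<forall>S \<in> covers X c. generated_sieve Y (f ` S) \<in> covers Y (f c))"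

definition J_ideal :: "'a site \<Rightarrow> 'a set \<Rightarrow> bool" where
  "J_ideal X I \<longleftrightarrow> I \<subseteq> carrier X \<and>
     (\<forall>c \<in> I. \<forall>d \<in> carrier X. d \<sqsubseteq>\<^bsub>X\<^esub> c \<longrightarrow> d \<in> I) \<and>
     (\<forall>c \<in> carrier X. \<forall>S \<in> covers X c. S \<subseteq> I \<longrightarrow> c \<in> I)"

definition ideal_frame :: "'a site \<Rightarrow> 'a set gorder" where
  "ideal_frame X = \<lparr>carrier = {I. J_ideal X I}, eq = (=), le = (\<subseteq>)\<rparr>"

definition ideal_gen :: "'a site \<Rightarrow> 'a set \<Rightarrow> 'a set" where
  "ideal_gen X A = \<Inter>{I. J_ideal X I \<and> A \<subseteq> I}"

definition principal_ideals :: "'a site \<Rightarrow> 'a set set" where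
  "principal_ideals X = (\<lambda>c. ideal_gen X {c}) ` carrier X"

definition site_category :: "('a site, 'a \<Rightarrow> 'a) cat \<Rightarrow> bool" where
  "site_category K \<longleftrightarrow> category K \<and>
     (\<forall>X \<in> Ob K. partial_order X \<and> grothendieck_topology X \<and> subcanonical X) \<and>
     (\<forall>X \<in> Ob K. \<forall>Y \<in> Ob K. \<forall>f \<in> Hom K X Y. f \<in> extensional (carrier X) \<and> site_morphism X Y f) \<and>
     (\<forall>X \<in> Ob K. Ident K X = (\<lambda>x\<in>carrier X. x)) \<and>
     (\<forall>X \<in> Ob K. \<forall>Y \<in> Ob K. \<forall>Z \<in> Ob K. \<forall>f \<in> Hom K X Y. \<forall>g \<in> Hom K Y Z.
        Comp K X Y Z g f = compose (carrier X) g f)"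

text \<open>The functor \<open>A : K\<^sup>o\<^sup>p \<rightarrow> Loc\<close>. An arrow \<open>X \<rightarrow> Y\<close> of \<open>K\<^sup>o\<^sup>p\<close> is a map \<open>f\<close> from the poset \<open>Y\<close> to
  the poset \<open>X\<close>, and its image is a locale morphism from the ideals of \<open>X\<close> to those of \<open>Y\<close>, that
  is, a frame homomorphism from the ideals of \<open>Y\<close> to those of \<open>X\<close>.\<close>

definition ideal_functor :: "('a site, 'a \<Rightarrow> 'a, 'a set gorder, 'a set \<Rightarrow> 'a set) func" where
  "ideal_functor = \<lparr>on_ob = ideal_frame,
     on_arr = (\<lambda>X Y f. \<lambda>I\<in>carrier (ideal_frame Y). ideal_gen X (f ` I))\<rparr>"

text \<open>
  Sizes: the type \<open>'a\<close> of elements of the posets plays the role of the universe, and frames have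
  elements of type \<open>'l = 'a set\<close>, as the frames of ideals do. For the frames occurring in the
  definition of \<open>C\<close>-induced topologies this is no restriction: if \<open>i\<close> maps a poset with carrier
  in \<open>'a\<close> onto a basis of a frame, the frame embeds into \<open>'a set\<close> via \<open>l \<mapsto> {c. i c \<le> l}\<close>.

  Families are indexed, \<open>C L I a\<close> meaning that the family of the \<open>a i\<close> (\<open>i \<in> I\<close>) of elements of
  \<open>L\<close> has the property \<open>C\<close>; so \<open>C\<close> may depend on repetitions. Indices are again taken from \<open>'l\<close>;
  in particular every set of elements of a frame is a family indexed by itself.
\<close>

type_synonym 'l family_property = "'l gorder \<Rightarrow> 'l set \<Rightarrow> ('l \<Rightarrow> 'l) \<Rightarrow> bool"

definition invariant_family_property :: "'l family_property \<Rightarrow> bool" where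
  "invariant_family_property C \<longleftrightarrow>
     (\<forall>L M \<phi> I a. frame L \<longrightarrow> frame M \<longrightarrow> is_iso Frm L M \<phi> \<longrightarrow> a \<in> I \<rightarrow>\<^sub>E carrier L \<longrightarrow>
        (C L I a \<longleftrightarrow> C M I (compose I \<phi> a)))"

definition invariant_basis_property :: "('l gorder \<Rightarrow> 'l set \<Rightarrow> bool) \<Rightarrow> bool" where
  "invariant_basis_property P \<longleftrightarrow>
     (\<forall>L M \<phi> B. frame L \<longrightarrow> frame M \<longrightarrow> is_iso Frm L M \<phi> \<longrightarrow> frame_basis L B \<longrightarrow>
        (P L B \<longleftrightarrow> P M (\<phi> ` B)))"

definition refines :: "'l gorder \<Rightarrow> 'l set \<Rightarrow> ('l \<Rightarrow> 'l) \<Rightarrow> 'l set \<Rightarrow> ('l \<Rightarrow> 'l) \<Rightarrow> bool" where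
  "refines L J b I a \<longleftrightarrow>
     (\<forall>j \<in> J. \<exists>i \<in> I. b j \<sqsubseteq>\<^bsub>L\<^esub> a i) \<and> \<Squnion>\<^bsub>L\<^esub> (b ` J) = \<Squnion>\<^bsub>L\<^esub> (a ` I)"

text \<open>The family \<open>(I, a)\<close> has a refinement satisfying \<open>C\<close> made of elements of \<open>B\<close>.\<close>

definition has_refinement_in ::
  "'l family_property \<Rightarrow> 'l gorder \<Rightarrow> 'l set \<Rightarrow> 'l set \<Rightarrow> ('l \<Rightarrow> 'l) \<Rightarrow> bool" where
  "has_refinement_in C L B I a \<longleftrightarrow> (\<exists>J. \<exists>b \<in> J \<rightarrow>\<^sub>E B. refines L J b I a \<and> C L J b)"

definition C_compact :: "'l family_property \<Rightarrow> 'l gorder \<Rightarrow> 'l \<Rightarrow> bool" where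
  "C_compact C L l \<longleftrightarrow> l \<in> carrier L \<and>
     (\<forall>I. \<forall>a \<in> I \<rightarrow>\<^sub>E carrier L. \<Squnion>\<^bsub>L\<^esub> (a ` I) = l \<longrightarrow> has_refinement_in C L (carrier L) I a)"

definition compact_poset :: "'l family_property \<Rightarrow> 'l gorder \<Rightarrow> 'l gorder" where
  "compact_poset C L = L\<lparr>carrier := {l. C_compact C L l}\<rparr>"

definition C_induced_relative ::
  "'a set family_property \<Rightarrow> ('a set gorder \<Rightarrow> 'a set set \<Rightarrow> bool) \<Rightarrow> 'a site \<Rightarrow> bool" where
  "C_induced_relative C P X \<longleftrightarrow>
     (\<forall>L i. frame L \<longrightarrow>
        i \<in> carrier X \<rightarrow> carrier L \<longrightarrow>
        (\<forall>c \<in> carrier X. \<forall>d \<in> carrier X. c \<sqsubseteq>\<^bsub>X\<^esub> d \<longleftrightarrow> i c \<sqsubseteq>\<^bsub>L\<^esub> i d) \<longrightarrow>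
        frame_basis L (i ` carrier X) \<longrightarrow>
        P L (i ` carrier X) \<longrightarrow>
        (\<forall>c \<in> carrier X. \<forall>S \<in> covers X c. i c = \<Squnion>\<^bsub>L\<^esub> (i ` S)) \<longrightarrow>
        (\<forall>I. \<forall>a \<in> I \<rightarrow>\<^sub>E carrier X.
           (\<exists>c \<in> carrier X. (\<forall>k \<in> I. a k \<sqsubseteq>\<^bsub>X\<^esub> c) \<and> generated_sieve X (a ` I) \<in> covers X c) \<longleftrightarrow>
           has_refinement_in C L (i ` carrier X) I (compose I i a)))"

definition C_induced :: "('a site, 'a \<Rightarrow> 'a) cat \<Rightarrow> 'a set family_property \<Rightarrow> 'a site \<Rightarrow> bool" where
  "C_induced K C X \<longleftrightarrow>
     (\<exists>P. invariant_basis_property P \<and>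
        (\<forall>Y \<in> Ob K. P (ideal_frame Y) (down Y ` carrier Y)) \<and>
        C_induced_relative C P X)"

text \<open>
  The functor \<open>G\<close> into \<open>K\<^sup>o\<^sup>p\<close> sends \<open>L\<close> to its poset of \<open>C\<close>-compact elements and a locale
  morphism to the restriction of its frame homomorphism. As \<open>K\<close> is not assumed to be closed under
  isomorphic copies of its objects, this is meant up to order isomorphisms \<open>\<phi> L\<close> identifying the
  object \<open>G L\<close> of \<open>K\<close> with the poset of \<open>C\<close>-compact elements of \<open>L\<close>, naturally in \<open>L\<close>.
\<close>

definition given_by_compact_elements ::
  "'l family_property \<Rightarrow> ('l gorder, 'l \<Rightarrow> 'l) cat \<Rightarrow>
   ('l gorder, 'l \<Rightarrow> 'l, 'a site, 'a \<Rightarrow> 'a) func \<Rightarrow> bool" where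
  "given_by_compact_elements C \<E> G \<longleftrightarrow>
     (\<exists>\<phi>. (\<forall>L \<in> Ob \<E>. order_iso (on_ob G L) (compact_poset C L) (\<phi> L)) \<and>
        (\<forall>L \<in> Ob \<E>. \<forall>L' \<in> Ob \<E>. \<forall>f \<in> Hom \<E> L L'.
           f ` carrier (compact_poset C L') \<subseteq> carrier (compact_poset C L) \<and>
           (\<forall>x \<in> carrier (on_ob G L'). \<phi> L (on_arr G L L' f x) = f (\<phi> L' x))))"

end

theory Submission
  imports Defs
begin

text \<open>
  The theorem separates into a purely categorical half and an order-theoretic half.

  Categorically, a faithful functor \<open>F\<close> that creates isomorphisms is an equivalence onto its extended
  image. Two presentations \<open>x \<cong> F A\<close> and \<open>x \<cong> F B\<close> of the same object differ by an isomorphism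
  \<open>F A \<cong> F B\<close>, which comes from \<open>A \<cong> B\<close>; hence membership of an arrow in the extended image can be
  tested on any fixed presentation of its source and target (\<open>Hom_ExtIm_iff\<close>). The extended image is
  therefore closed under composition, and after choosing one presentation \<open>\<alpha> x : x \<cong> F (G x)\<close> for
  each \<open>x\<close>, every arrow lifts along the chosen presentations, uniquely because \<open>F\<close> is faithful. The
  lifts make \<open>G\<close> a functor inverse to \<open>F\<close>, with \<open>F (G f) \<circ> \<alpha> x = \<alpha> y \<circ> f\<close>
  (\<open>faithful_imp_categorical_inverse\<close>).

  The ideal functor is faithful because, by subcanonicity, the principal ideal of \<open>c\<close> is
  \<open>{d. d \<le> c}\<close>, from which \<open>c\<close> can be recovered, and the frame homomorphism induced by \<open>f\<close> sends
  the principal ideal of \<open>c\<close> to that of \<open>f c\<close>.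

  It remains to recognise the poset \<open>X\<close> inside its frame of ideals. The topology being \<open>C\<close>-induced
  is applied to that frame and the embedding \<open>c \<mapsto> {d. d \<le> c}\<close>: a family generates
  a covering sieve on one of its upper bounds exactly when the corresponding principal ideals have a
  refinement by principal ideals that satisfies \<open>C\<close>. If an ideal \<open>l\<close> is \<open>C\<close>-compact, this applies to
  the family of all its elements, which consequently covers some \<open>c\<close>; then \<open>c \<in> l\<close> and
  \<open>l = {d. d \<le> c}\<close>. Conversely, if ideals have join \<open>{d. d \<le> c}\<close>, their union is a covering sieve on
  \<open>c\<close>, so it has a principal refinement satisfying \<open>C\<close>, and this refines the given ideals. Thus the
  \<open>C\<close>-compact ideals are exactly the principal ones (\<open>order_iso_down_compact\<close>). As \<open>C\<close> is invariant,
  the presentation \<open>\<alpha> L\<close> carries them to the \<open>C\<close>-compact elements of \<open>L\<close>, and the equation for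
  \<open>F (G f)\<close>, evaluated at principal ideals, says that \<open>G f\<close> is the restriction of \<open>f\<close>.
\<close>

section \<open>Faithful functors that create isomorphisms\<close>

lemma (in category) is_iso_Ident:
  assumes "X \<in> Ob \<X>"
  shows "is_iso \<X> X X (Ident \<X> X)"
  using assms by (auto simp: is_iso_def Ident_in_Hom Comp_Ident_left)

lemma is_iso_in_Hom: "is_iso \<X> X Y f \<Longrightarrow> f \<in> Hom \<X> X Y"
  by (simp add: is_iso_def)

lemma is_isoE:
  assumes "is_iso \<X> X Y f"
  obtains g where "is_iso \<X> Y X g" "g \<in> Hom \<X> Y X"
    "Comp \<X> X Y X g f = Ident \<X> X" "Comp \<X> Y X Y f g = Ident \<X> Y"
  using assms unfolding is_iso_def by blast

lemma (in category) Comp_cancel_left: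
  assumes "W \<in> Ob \<X>" "X \<in> Ob \<X>" "Y \<in> Ob \<X>"
    and "h \<in> Hom \<X> W X" "f \<in> Hom \<X> X Y" "g \<in> Hom \<X> Y X"
    and "Comp \<X> X Y X g f = Ident \<X> X"
  shows "Comp \<X> W Y X g (Comp \<X> W X Y f h) = h"
  using assms Comp_assoc[of W X Y X h f g] by (simp add: Comp_Ident_left)

lemma (in category) is_iso_Comp:
  assumes X: "X \<in> Ob \<X>" "Y \<in> Ob \<X>" "Z \<in> Ob \<X>"
    and "is_iso \<X> X Y f" "is_iso \<X> Y Z g"
  shows "is_iso \<X> X Z (Comp \<X> X Y Z g f)"
proof -
  obtain f' where f': "f' \<in> Hom \<X> Y X"
    "Comp \<X> X Y X f' f = Ident \<X> X" "Comp \<X> Y X Y f f' = Ident \<X> Y"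
    using assms(4) by (rule is_isoE)
  obtain g' where g': "g' \<in> Hom \<X> Z Y"
    "Comp \<X> Y Z Y g' g = Ident \<X> Y" "Comp \<X> Z Y Z g g' = Ident \<X> Z"
    using assms(5) by (rule is_isoE)
  have fg: "f \<in> Hom \<X> X Y" "g \<in> Hom \<X> Y Z"
    using assms by (simp_all add: is_iso_in_Hom)
  have "Comp \<X> X Z X (Comp \<X> Z Y X f' g') (Comp \<X> X Y Z g f) = Ident \<X> X"
    using X fg f' g' Comp_cancel_left[of X Y Z f g g'] by (simp add: Comp_assoc Comp_in_Hom)
  moreover have "Comp \<X> Z X Z (Comp \<X> X Y Z g f) (Comp \<X> Z Y X f' g') = Ident \<X> Z"
    using X fg f' g' Comp_cancel_left[of Z Y X g' f' f] by (simp add: Comp_assoc Comp_in_Hom)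
  ultimately show ?thesis
    using X fg f' g' unfolding is_iso_def by (metis Comp_in_Hom)
qed

lemma op_cat_simps [simp]:
  "Ob (op_cat \<X>) = Ob \<X>" "Hom (op_cat \<X>) X Y = Hom \<X> Y X" "Ident (op_cat \<X>) = Ident \<X>"
  "Comp (op_cat \<X>) X Y Z g f = Comp \<X> Z Y X f g"
  by (simp_all add: op_cat_def)

lemma (in category) category_op_cat: "category (op_cat \<X>)"
  by standard
    (auto simp: Ident_in_Hom Comp_in_Hom Comp_Ident_left Comp_Ident_right Comp_assoc)

lemma is_iso_op_cat: "is_iso (op_cat \<X>) X Y f \<longleftrightarrow> is_iso \<X> Y X f"
  by (auto simp: is_iso_def op_cat_def)

locale iso_creating_functor =
  fixes \<X> :: "('o, 'm) cat" and \<Y> :: "('p, 'n) cat" and F :: "('o, 'm, 'p, 'n) func"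
  assumes is_functor: "is_functor \<X> \<Y> F"
    and creates_isos: "creates_isos \<X> \<Y> F"
begin

sublocale X: category \<X>
  using is_functor by (simp add: is_functor_def)

sublocale Y: category \<Y>
  using is_functor by (simp add: is_functor_def)

abbreviation "\<E> \<equiv> ExtIm \<X> \<Y> F"

lemma F_ob: "A \<in> Ob \<X> \<Longrightarrow> on_ob F A \<in> Ob \<Y>"
  and F_arr: "\<lbrakk>A \<in> Ob \<X>; B \<in> Ob \<X>; u \<in> Hom \<X> A B\<rbrakk>
      \<Longrightarrow> on_arr F A B u \<in> Hom \<Y> (on_ob F A) (on_ob F B)"
  and F_Ident: "A \<in> Ob \<X> \<Longrightarrow> on_arr F A A (Ident \<X> A) = Ident \<Y> (on_ob F A)"
  and F_Comp: "\<lbrakk>A \<in> Ob \<X>; B \<in> Ob \<X>; D \<in> Ob \<X>; u \<in> Hom \<X> A B; v \<in> Hom \<X> B D\<rbrakk>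
      \<Longrightarrow> on_arr F A D (Comp \<X> A B D v u) =
        Comp \<Y> (on_ob F A) (on_ob F B) (on_ob F D) (on_arr F B D v) (on_arr F A B u)"
  using is_functor unfolding is_functor_def by blast+

lemma ExtIm_simps:
  "x \<in> Ob \<E> \<longleftrightarrow> x \<in> Ob \<Y> \<and> (\<exists>A \<in> Ob \<X>. \<exists>\<alpha>. is_iso \<Y> x (on_ob F A) \<alpha>)"
  "Ident \<E> = Ident \<Y>" "Comp \<E> = Comp \<Y>"
  by (auto simp: ExtIm_def)

text \<open>
  The comparison \<open>\<beta> \<circ> \<alpha>\<inverse>\<close> of two presentations of the same object is an isomorphism between values
  of \<open>F\<close>, hence is created by \<open>F\<close>.
\<close>

lemma iso_lift:
  assumes "A \<in> Ob \<X>" "B \<in> Ob \<X>" "x \<in> Ob \<Y>"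
    and "is_iso \<Y> x (on_ob F A) \<alpha>" "is_iso \<Y> x (on_ob F B) \<beta>"
  obtains w where "is_iso \<X> A B w" "w \<in> Hom \<X> A B"
    "Comp \<Y> x (on_ob F A) (on_ob F B) (on_arr F A B w) \<alpha> = \<beta>"
proof -
  obtain \<alpha>' where \<alpha>': "is_iso \<Y> (on_ob F A) x \<alpha>'" "Comp \<Y> x (on_ob F A) x \<alpha>' \<alpha> = Ident \<Y> x"
    using assms(4) by (rule is_isoE)
  have "is_iso \<Y> (on_ob F A) (on_ob F B) (Comp \<Y> (on_ob F A) x (on_ob F B) \<beta> \<alpha>')"
    using assms \<alpha>' by (simp add: F_ob Y.is_iso_Comp)
  then obtain w where w: "is_iso \<X> A B w"
    "on_arr F A B w = Comp \<Y> (on_ob F A) x (on_ob F B) \<beta> \<alpha>'"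
    using creates_isos assms unfolding creates_isos_def by blast
  moreover have "Comp \<Y> x (on_ob F A) (on_ob F B) (on_arr F A B w) \<alpha> = \<beta>"
    using assms \<alpha>' w(2) by (simp add: Y.Comp_assoc F_ob is_iso_in_Hom Y.Comp_Ident_right)
  ultimately show thesis
    using that by (simp add: is_iso_in_Hom)
qed

text \<open>
  An arrow belongs to the extended image as soon as some presentations of its ends exhibit it as a
  value of \<open>F\<close>. By \<open>iso_lift\<close> the choice of presentations is immaterial, which is what allows
  arrows with a common end to be composed.
\<close>

lemma Hom_ExtIm_iff:
  assumes "x \<in> Ob \<Y>" "y \<in> Ob \<Y>" "A \<in> Ob \<X>" "B \<in> Ob \<X>"
    and "is_iso \<Y> x (on_ob F A) \<alpha>" "is_iso \<Y> y (on_ob F B) \<beta>"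
  shows "f \<in> Hom \<E> x y \<longleftrightarrow> f \<in> Hom \<Y> x y \<and> (\<exists>u \<in> Hom \<X> A B.
    Comp \<Y> x (on_ob F A) (on_ob F B) (on_arr F A B u) \<alpha> = Comp \<Y> x y (on_ob F B) \<beta> f)"
    (is "_ \<longleftrightarrow> _ \<and> ?conj")
proof
  assume "f \<in> Hom \<E> x y"
  then obtain A0 B0 u \<alpha>0 \<beta>0 where f: "f \<in> Hom \<Y> x y"
    and ob: "A0 \<in> Ob \<X>" "B0 \<in> Ob \<X>" and u: "u \<in> Hom \<X> A0 B0"
    and iso: "is_iso \<Y> x (on_ob F A0) \<alpha>0" "is_iso \<Y> y (on_ob F B0) \<beta>0"
    and eq: "Comp \<Y> x y (on_ob F B0) \<beta>0 f =
      Comp \<Y> x (on_ob F A0) (on_ob F B0) (on_arr F A0 B0 u) \<alpha>0"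
    unfolding ExtIm_def by auto
  obtain v where v: "v \<in> Hom \<X> A A0"
    "Comp \<Y> x (on_ob F A) (on_ob F A0) (on_arr F A A0 v) \<alpha> = \<alpha>0"
    using assms ob iso by (metis iso_lift)
  obtain w where w: "w \<in> Hom \<X> B0 B"
    "Comp \<Y> y (on_ob F B0) (on_ob F B) (on_arr F B0 B w) \<beta>0 = \<beta>"
    using assms ob iso by (metis iso_lift)
  have "Comp \<Y> x (on_ob F A) (on_ob F B) (on_arr F A B (Comp \<X> A B0 B w (Comp \<X> A A0 B0 u v))) \<alpha> =
    Comp \<Y> x (on_ob F B0) (on_ob F B) (on_arr F B0 B w)
      (Comp \<Y> x (on_ob F A0) (on_ob F B0) (on_arr F A0 B0 u) \<alpha>0)"
    using assms ob u v(1) w(1) unfolding v(2)[symmetric]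
    by (simp add: F_Comp F_ob F_arr is_iso_in_Hom X.Comp_in_Hom Y.Comp_in_Hom Y.Comp_assoc)
  also have "\<dots> = Comp \<Y> x y (on_ob F B) \<beta> f"
    using assms ob w(1) f iso unfolding eq[symmetric] w(2)[symmetric]
    by (simp add: F_ob F_arr is_iso_in_Hom Y.Comp_assoc)
  finally show "f \<in> Hom \<Y> x y \<and> ?conj"
    using f X.Comp_in_Hom assms ob u v(1) w(1) by metis
next
  assume "f \<in> Hom \<Y> x y \<and> ?conj"
  then show "f \<in> Hom \<E> x y"
    using assms(3-) unfolding ExtIm_def by simp metis
qed

lemma on_arr_in_ExtIm:
  assumes "A \<in> Ob \<X>" "B \<in> Ob \<X>" "u \<in> Hom \<X> A B"
  shows "on_arr F A B u \<in> Hom \<E> (on_ob F A) (on_ob F B)"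
  using Hom_ExtIm_iff[OF _ _ assms(1,2) Y.is_iso_Ident Y.is_iso_Ident] assms
  by (auto simp: F_ob F_arr Y.Comp_Ident_left Y.Comp_Ident_right)

text \<open>
  If \<open>\<beta>\<close> presents the target of \<open>f\<close>, then \<open>\<beta> \<circ> f\<close> presents its source, and with respect to these two
  presentations \<open>f\<close> corresponds to an identity.
\<close>

lemma iso_in_ExtIm:
  assumes "x \<in> Ob \<E>" "y \<in> Ob \<E>" "is_iso \<Y> x y f"
  shows "f \<in> Hom \<E> x y"
proof -
  obtain B \<beta> where B: "B \<in> Ob \<X>" "is_iso \<Y> y (on_ob F B) \<beta>"
    using assms by (auto simp: ExtIm_simps)
  have ob: "x \<in> Ob \<Y>" "y \<in> Ob \<Y>"
    using assms by (auto simp: ExtIm_simps)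
  have iso: "is_iso \<Y> x (on_ob F B) (Comp \<Y> x y (on_ob F B) \<beta> f)"
    using ob B assms by (simp add: F_ob Y.is_iso_Comp)
  have "Comp \<Y> x (on_ob F B) (on_ob F B) (on_arr F B B (Ident \<X> B)) (Comp \<Y> x y (on_ob F B) \<beta> f)
      = Comp \<Y> x y (on_ob F B) \<beta> f"
    using B ob is_iso_in_Hom[OF iso] by (simp add: F_Ident F_ob Y.Comp_Ident_left)
  then show ?thesis
    using Hom_ExtIm_iff[OF ob B(1) B(1) iso B(2)] B X.Ident_in_Hom is_iso_in_Hom[OF assms(3)]
    by blast
qed

lemma is_iso_ExtIm:
  assumes "x \<in> Ob \<E>" "y \<in> Ob \<E>" "is_iso \<Y> x y f"
  shows "is_iso \<E> x y f"
proof -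
  obtain g where "is_iso \<Y> y x g" "Comp \<Y> x y x g f = Ident \<Y> x" "Comp \<Y> y x y f g = Ident \<Y> y"
    using assms(3) by (rule is_isoE)
  then show ?thesis
    unfolding is_iso_def[of "\<E>"] ExtIm_simps using iso_in_ExtIm assms by blast
qed

lemma Hom_ExtIm_subset: "f \<in> Hom \<E> x y \<Longrightarrow> f \<in> Hom \<Y> x y"
  by (auto simp: ExtIm_def)

lemma Comp_in_ExtIm:
  assumes "x \<in> Ob \<E>" "y \<in> Ob \<E>" "z \<in> Ob \<E>" "f \<in> Hom \<E> x y" "g \<in> Hom \<E> y z"
  shows "Comp \<Y> x y z g f \<in> Hom \<E> x z"
proof -
  obtain A \<alpha> B \<beta> D \<gamma> where ob: "A \<in> Ob \<X>" "B \<in> Ob \<X>" "D \<in> Ob \<X>"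
    and iso: "is_iso \<Y> x (on_ob F A) \<alpha>" "is_iso \<Y> y (on_ob F B) \<beta>" "is_iso \<Y> z (on_ob F D) \<gamma>"
    using assms unfolding ExtIm_simps by metis
  have xyz: "x \<in> Ob \<Y>" "y \<in> Ob \<Y>" "z \<in> Ob \<Y>"
    using assms by (auto simp: ExtIm_simps)
  obtain u where u: "u \<in> Hom \<X> A B"
    "Comp \<Y> x (on_ob F A) (on_ob F B) (on_arr F A B u) \<alpha> = Comp \<Y> x y (on_ob F B) \<beta> f"
    using Hom_ExtIm_iff[OF xyz(1,2) ob(1,2) iso(1,2)] assms by blast
  obtain v where v: "v \<in> Hom \<X> B D"
    "Comp \<Y> y (on_ob F B) (on_ob F D) (on_arr F B D v) \<beta> = Comp \<Y> y z (on_ob F D) \<gamma> g"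
    using Hom_ExtIm_iff[OF xyz(2,3) ob(2,3) iso(2,3)] assms by blast
  have fg: "f \<in> Hom \<Y> x y" "g \<in> Hom \<Y> y z"
    using assms Hom_ExtIm_subset by blast+
  note typing = xyz ob fg u(1) v(1) iso[THEN is_iso_in_Hom]
  have "Comp \<Y> x (on_ob F A) (on_ob F D) (on_arr F A D (Comp \<X> A B D v u)) \<alpha>
      = Comp \<Y> x (on_ob F B) (on_ob F D) (on_arr F B D v) (Comp \<Y> x y (on_ob F B) \<beta> f)"
    using typing by (simp add: F_Comp F_ob F_arr Y.Comp_assoc u(2))
  also have "\<dots> = Comp \<Y> x y (on_ob F D) (Comp \<Y> y z (on_ob F D) \<gamma> g) f"
    using typing unfolding v(2)[symmetric] by (simp add: F_ob F_arr Y.Comp_assoc)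
  also have "\<dots> = Comp \<Y> x z (on_ob F D) \<gamma> (Comp \<Y> x y z g f)"
    using typing by (simp add: F_ob Y.Comp_assoc)
  finally show ?thesis
    using Hom_ExtIm_iff[OF xyz(1,3) ob(1,3) iso(1,3)] X.Comp_in_Hom[OF ob u(1) v(1)]
      Y.Comp_in_Hom[OF xyz fg] by blast
qed

lemma category_ExtIm: "category \<E>"
proof
  show "Ident \<E> x \<in> Hom \<E> x x" if "x \<in> Ob \<E>" for x
    using that iso_in_ExtIm Y.is_iso_Ident by (auto simp: ExtIm_simps)
  show "Comp \<E> x y z g f \<in> Hom \<E> x z"
    if "x \<in> Ob \<E>" "y \<in> Ob \<E>" "z \<in> Ob \<E>" "f \<in> Hom \<E> x y" "g \<in> Hom \<E> y z" for x y z f g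
    using that Comp_in_ExtIm by (simp add: ExtIm_simps)
qed (auto simp: ExtIm_simps dest!: Hom_ExtIm_subset
    intro!: Y.Comp_Ident_left Y.Comp_Ident_right Y.Comp_assoc)

lemma on_ob_in_ExtIm: "A \<in> Ob \<X> \<Longrightarrow> on_ob F A \<in> Ob \<E>"
  using F_ob Y.is_iso_Ident by (auto simp: ExtIm_simps)

lemma is_functor_ExtIm: "is_functor \<X> \<E> F"
  using is_functor category_ExtIm on_ob_in_ExtIm on_arr_in_ExtIm
  by (simp add: is_functor_def ExtIm_simps)

text \<open>
  The presentations \<open>\<alpha>\<close> are returned together with \<open>G\<close>, since the values of \<open>G\<close> are determined only
  through them and their naturality is what describes \<open>G\<close> on arrows.
\<close>

theorem faithful_imp_categorical_inverse:
  assumes faithful: "\<And>A B u v. \<lbrakk>A \<in> Ob \<X>; B \<in> Ob \<X>; u \<in> Hom \<X> A B; v \<in> Hom \<X> A B;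
      on_arr F A B u = on_arr F A B v\<rbrakk> \<Longrightarrow> u = v"
  obtains G \<alpha> where "categorical_inverse \<X> \<E> F G"
    and "\<And>x. x \<in> Ob \<E> \<Longrightarrow> is_iso \<Y> x (on_ob F (on_ob G x)) (\<alpha> x)"
    and "\<And>x y f. \<lbrakk>x \<in> Ob \<E>; y \<in> Ob \<E>; f \<in> Hom \<E> x y\<rbrakk> \<Longrightarrow>
      Comp \<Y> x (on_ob F (on_ob G x)) (on_ob F (on_ob G y))
        (on_arr F (on_ob G x) (on_ob G y) (on_arr G x y f)) (\<alpha> x) =
      Comp \<Y> x y (on_ob F (on_ob G y)) (\<alpha> y) f"
proof -
  have "\<forall>x \<in> Ob \<E>. \<exists>A \<alpha>. A \<in> Ob \<X> \<and> is_iso \<Y> x (on_ob F A) \<alpha>"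
    using ExtIm_simps(1) by blast
  then obtain G0 \<alpha> where G0: "\<And>x. x \<in> Ob \<E> \<Longrightarrow> G0 x \<in> Ob \<X>"
    and \<alpha>: "\<And>x. x \<in> Ob \<E> \<Longrightarrow> is_iso \<Y> x (on_ob F (G0 x)) (\<alpha> x)"
    by metis
  let ?F0 = "\<lambda>x. on_ob F (G0 x)"
  have obY: "x \<in> Ob \<Y>" if "x \<in> Ob \<E>" for x
    using that by (simp add: ExtIm_simps)
  \<comment> \<open>Lifts along the chosen presentations exist by \<open>Hom_ExtIm_iff\<close> and are unique by faithfulness.\<close>
  define lifts where "lifts x y f u \<longleftrightarrow> u \<in> Hom \<X> (G0 x) (G0 y) \<and>
    Comp \<Y> x (?F0 x) (?F0 y) (on_arr F (G0 x) (G0 y) u) (\<alpha> x) = Comp \<Y> x y (?F0 y) (\<alpha> y) f"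
    for x y f u
  define G1 where "G1 x y f = (SOME u. lifts x y f u)" for x y f
  have "\<exists>u. lifts x y f u" if "x \<in> Ob \<E>" "y \<in> Ob \<E>" "f \<in> Hom \<E> x y" for x y f
    using Hom_ExtIm_iff[OF obY obY G0 G0 \<alpha> \<alpha>] that unfolding lifts_def by blast
  then have lifts_G1: "lifts x y f (G1 x y f)" if "x \<in> Ob \<E>" "y \<in> Ob \<E>" "f \<in> Hom \<E> x y" for x y f
    using that unfolding G1_def by (metis someI_ex)
  then have G1: "G1 x y f \<in> Hom \<X> (G0 x) (G0 y)"
    and nat: "Comp \<Y> x (?F0 x) (?F0 y) (on_arr F (G0 x) (G0 y) (G1 x y f)) (\<alpha> x) =
      Comp \<Y> x y (?F0 y) (\<alpha> y) f"
    if "x \<in> Ob \<E>" "y \<in> Ob \<E>" "f \<in> Hom \<E> x y" for x y f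
    using that unfolding lifts_def by blast+
  have lifts_unique: "u = v" if x: "x \<in> Ob \<E>" "y \<in> Ob \<E>" and uv: "lifts x y f u" "lifts x y f v"
    for x y f u v
  proof (rule faithful)
    obtain \<alpha>' where \<alpha>': "\<alpha>' \<in> Hom \<Y> (?F0 x) x"
      "Comp \<Y> (?F0 x) x (?F0 x) (\<alpha> x) \<alpha>' = Ident \<Y> (?F0 x)"
      using \<alpha> x by (metis is_isoE)
    have "on_arr F (G0 x) (G0 y) w = Comp \<Y> (?F0 x) x (?F0 y) (Comp \<Y> x y (?F0 y) (\<alpha> y) f) \<alpha>'"
      if "lifts x y f w" for w
    proof -
      have "Comp \<Y> (?F0 x) x (?F0 y) (Comp \<Y> x y (?F0 y) (\<alpha> y) f) \<alpha>' =
        Comp \<Y> (?F0 x) x (?F0 y) (Comp \<Y> x (?F0 x) (?F0 y) (on_arr F (G0 x) (G0 y) w) (\<alpha> x)) \<alpha>'"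
        using that unfolding lifts_def by simp
      also have "\<dots> = on_arr F (G0 x) (G0 y) w"
        using conjunct1[OF that[unfolded lifts_def]] x G0 \<alpha>' is_iso_in_Hom[OF \<alpha>]
        by (simp add: Y.Comp_assoc F_ob F_arr obY Y.Comp_Ident_right)
      finally show ?thesis ..
    qed
    then show "on_arr F (G0 x) (G0 y) u = on_arr F (G0 x) (G0 y) v"
      using uv by metis
  qed (use x uv G0 in \<open>auto simp: lifts_def\<close>)
  define G where "G = \<lparr>on_ob = G0, on_arr = G1\<rparr>"
  have G_simps [simp]: "on_ob G = G0" "on_arr G = G1"
    by (simp_all add: G_def)
  have "G1 x x (Ident \<Y> x) = Ident \<X> (G0 x)" if x: "x \<in> Ob \<E>" for x
  proof (rule lifts_unique[OF x x lifts_G1])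
    show "lifts x x (Ident \<Y> x) (Ident \<X> (G0 x))"
      using x is_iso_in_Hom[OF \<alpha>] unfolding lifts_def
      by (simp add: G0 X.Ident_in_Hom F_Ident F_ob obY Y.Comp_Ident_left Y.Comp_Ident_right)
  qed (use x category.Ident_in_Hom[OF category_ExtIm] in \<open>auto simp: ExtIm_simps\<close>)
  moreover have "G1 x z (Comp \<Y> x y z g f) = Comp \<X> (G0 x) (G0 y) (G0 z) (G1 y z g) (G1 x y f)"
    if x: "x \<in> Ob \<E>" "y \<in> Ob \<E>" "z \<in> Ob \<E>" and fg: "f \<in> Hom \<E> x y" "g \<in> Hom \<E> y z" for x y z f g
  proof (rule lifts_unique[OF x(1,3) lifts_G1])
    note typing = x G0 obY F_ob fg[THEN Hom_ExtIm_subset] is_iso_in_Hom[OF \<alpha>] G1 F_arr fg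
    have "Comp \<Y> x (?F0 x) (?F0 z)
        (on_arr F (G0 x) (G0 z) (Comp \<X> (G0 x) (G0 y) (G0 z) (G1 y z g) (G1 x y f))) (\<alpha> x) =
      Comp \<Y> x (?F0 y) (?F0 z) (on_arr F (G0 y) (G0 z) (G1 y z g)) (Comp \<Y> x y (?F0 y) (\<alpha> y) f)"
      using typing by (simp add: F_Comp Y.Comp_assoc nat)
    also have "\<dots> = Comp \<Y> x y (?F0 z) (Comp \<Y> y z (?F0 z) (\<alpha> z) g) f"
      using typing nat[OF x(2,3) fg(2)] by (simp flip: Y.Comp_assoc)
    also have "\<dots> = Comp \<Y> x z (?F0 z) (\<alpha> z) (Comp \<Y> x y z g f)"
      using typing by (simp add: Y.Comp_assoc)
    finally show "lifts x z (Comp \<Y> x y z g f) (Comp \<X> (G0 x) (G0 y) (G0 z) (G1 y z g) (G1 x y f))"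
      using typing by (simp add: lifts_def X.Comp_in_Hom)
  qed (use x fg Comp_in_ExtIm in auto)
  ultimately have functor_G: "is_functor \<E> \<X> G"
    using category_ExtIm X.category_axioms G0 G1 by (simp add: is_functor_def ExtIm_simps(2,3))
  have "naturally_isomorphic \<X> \<X> id_func (comp_func G F)"
  proof -
    \<comment> \<open>The presentation chosen for \<open>F A\<close> is an isomorphism between values of \<open>F\<close>, hence lifts.\<close>
    have "\<exists>\<eta>. is_iso \<X> A (G0 (on_ob F A)) \<eta> \<and> on_arr F A (G0 (on_ob F A)) \<eta> = \<alpha> (on_ob F A)"
      if "A \<in> Ob \<X>" for A
      using creates_isos \<alpha>[OF on_ob_in_ExtIm[OF that]] G0[OF on_ob_in_ExtIm[OF that]] that
      unfolding creates_isos_def by blast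
    then obtain \<eta> where \<eta>: "\<And>A. A \<in> Ob \<X> \<Longrightarrow> is_iso \<X> A (G0 (on_ob F A)) (\<eta> A)"
      and F\<eta>: "\<And>A. A \<in> Ob \<X> \<Longrightarrow> on_arr F A (G0 (on_ob F A)) (\<eta> A) = \<alpha> (on_ob F A)"
      by metis
    have "Comp \<X> A B (G0 (on_ob F B)) (\<eta> B) u =
        Comp \<X> A (G0 (on_ob F A)) (G0 (on_ob F B))
          (G1 (on_ob F A) (on_ob F B) (on_arr F A B u)) (\<eta> A)"
      if "A \<in> Ob \<X>" "B \<in> Ob \<X>" "u \<in> Hom \<X> A B" for A B u
      using that G0 G1 on_ob_in_ExtIm on_arr_in_ExtIm is_iso_in_Hom[OF \<eta>]
      by (intro faithful[of A "G0 (on_ob F B)"]) (simp_all add: X.Comp_in_Hom F_Comp F\<eta> nat)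
    then show ?thesis
      unfolding naturally_isomorphic_def id_func_def comp_func_def
      using \<eta> by (intro exI[of _ \<eta>]) simp
  qed
  moreover have "naturally_isomorphic \<E> \<E> (comp_func F G) id_func"
  proof -
    have "\<exists>\<beta>. is_iso \<Y> (?F0 x) x \<beta> \<and> Comp \<Y> x (?F0 x) x \<beta> (\<alpha> x) = Ident \<Y> x \<and>
        Comp \<Y> (?F0 x) x (?F0 x) (\<alpha> x) \<beta> = Ident \<Y> (?F0 x)" if "x \<in> Ob \<E>" for x
      using \<alpha>[OF that] by (metis is_isoE)
    then obtain \<beta> where \<beta>: "\<And>x. x \<in> Ob \<E> \<Longrightarrow> is_iso \<Y> (?F0 x) x (\<beta> x)"
      and \<beta>\<alpha>: "\<And>x. x \<in> Ob \<E> \<Longrightarrow> Comp \<Y> x (?F0 x) x (\<beta> x) (\<alpha> x) = Ident \<Y> x"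
      and \<alpha>\<beta>: "\<And>x. x \<in> Ob \<E> \<Longrightarrow> Comp \<Y> (?F0 x) x (?F0 x) (\<alpha> x) (\<beta> x) = Ident \<Y> (?F0 x)"
      by metis
    have "Comp \<Y> (?F0 x) (?F0 y) y (\<beta> y) (on_arr F (G0 x) (G0 y) (G1 x y f)) =
        Comp \<Y> (?F0 x) x y f (\<beta> x)"
      if x: "x \<in> Ob \<E>" "y \<in> Ob \<E>" and f: "f \<in> Hom \<E> x y" for x y f
    proof -
      let ?u = "on_arr F (G0 x) (G0 y) (G1 x y f)"
      note typing = x G0 obY F_ob Hom_ExtIm_subset[OF f] is_iso_in_Hom[OF \<alpha>] is_iso_in_Hom[OF \<beta>]
        G1 F_arr f
      have "Comp \<Y> (?F0 x) (?F0 y) y (\<beta> y) ?u =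
        Comp \<Y> (?F0 x) (?F0 y) y (\<beta> y)
          (Comp \<Y> (?F0 x) x (?F0 y) (Comp \<Y> x (?F0 x) (?F0 y) ?u (\<alpha> x)) (\<beta> x))"
        using typing by (simp add: Y.Comp_assoc \<alpha>\<beta> Y.Comp_Ident_right)
      also have "\<dots> = Comp \<Y> (?F0 x) (?F0 y) y (\<beta> y)
          (Comp \<Y> (?F0 x) y (?F0 y) (\<alpha> y) (Comp \<Y> (?F0 x) x y f (\<beta> x)))"
        using typing by (simp add: nat Y.Comp_assoc)
      also have "\<dots> = Comp \<Y> (?F0 x) x y f (\<beta> x)"
        using typing by (intro Y.Comp_cancel_left) (simp_all add: \<beta>\<alpha> Y.Comp_in_Hom)
      finally show ?thesis .
    qed
    then show ?thesis
      unfolding naturally_isomorphic_def id_func_def comp_func_def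
      using \<beta> is_iso_ExtIm on_ob_in_ExtIm G0
      by (intro exI[of _ \<beta>]) (simp add: ExtIm_simps(3))
  qed
  ultimately have "categorical_inverse \<X> \<E> F G"
    using functor_G is_functor_ExtIm by (simp add: categorical_inverse_def)
  then show thesis
    using that[of G \<alpha>] \<alpha> nat by simp
qed

end

section \<open>Frames and transport of compact elements\<close>

lemma Frm_simps [simp]:
  "Ob Frm = {L. frame L}" "Hom Frm = frame_homs" "Ident Frm L = (\<lambda>x\<in>carrier L. x)"
  "Comp Frm L M N g f = compose (carrier L) g f"
  by (simp_all add: Frm_def)

lemma frame_imp_complete_lattice: "frame L \<Longrightarrow> complete_lattice L"
  by (simp add: frame_def)

lemma frame_top_closed: "frame L \<Longrightarrow> \<top>\<^bsub>L\<^esub> \<in> carrier L"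
proof -
  assume "frame L"
  then interpret complete_lattice L
    by (rule frame_imp_complete_lattice)
  show ?thesis by simp
qed

lemma frame_meet_closed:
  "frame L \<Longrightarrow> x \<in> carrier L \<Longrightarrow> y \<in> carrier L \<Longrightarrow> x \<sqinter>\<^bsub>L\<^esub> y \<in> carrier L"
proof -
  assume "frame L" and xy: "x \<in> carrier L" "y \<in> carrier L"
  then interpret complete_lattice L
    by (simp add: frame_imp_complete_lattice)
  show ?thesis using xy by simp
qed

lemma frame_sup_closed: "frame L \<Longrightarrow> A \<subseteq> carrier L \<Longrightarrow> \<Squnion>\<^bsub>L\<^esub> A \<in> carrier L"
proof -
  assume "frame L" and A: "A \<subseteq> carrier L"
  then interpret complete_lattice L
    by (simp add: frame_imp_complete_lattice)
  show ?thesis using A by simp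
qed

lemma frame_le_iff_sup:
  assumes "frame L" "x \<in> carrier L" "y \<in> carrier L"
  shows "x \<sqsubseteq>\<^bsub>L\<^esub> y \<longleftrightarrow> \<Squnion>\<^bsub>L\<^esub> {x, y} = y"
proof -
  interpret complete_lattice L
    using assms by (simp add: frame_imp_complete_lattice)
  show ?thesis
    using le_iff_meet[OF assms(2,3)] by (simp add: join_def)
qed

lemma frame_homD:
  assumes "f \<in> frame_homs L M"
  shows "f \<in> carrier L \<rightarrow>\<^sub>E carrier M"
    and "x \<in> carrier L \<Longrightarrow> f x \<in> carrier M"
    and "A \<subseteq> carrier L \<Longrightarrow> f (\<Squnion>\<^bsub>L\<^esub> A) = \<Squnion>\<^bsub>M\<^esub> (f ` A)"
    and "f \<top>\<^bsub>L\<^esub> = \<top>\<^bsub>M\<^esub>"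
    and "x \<in> carrier L \<Longrightarrow> y \<in> carrier L \<Longrightarrow> f (x \<sqinter>\<^bsub>L\<^esub> y) = f x \<sqinter>\<^bsub>M\<^esub> f y"
  using assms by (auto simp: frame_homs_def)

lemma frame_hom_mono:
  assumes "frame L" "frame M" "f \<in> frame_homs L M"
    and "x \<in> carrier L" "y \<in> carrier L" "x \<sqsubseteq>\<^bsub>L\<^esub> y"
  shows "f x \<sqsubseteq>\<^bsub>M\<^esub> f y"
  using assms frame_homD(3)[OF assms(3), of "{x, y}"]
  by (simp add: frame_le_iff_sup frame_homD(2))

lemma compose_in_frame_homs:
  assumes "frame L" "f \<in> frame_homs L M" "g \<in> frame_homs M N"
  shows "compose (carrier L) g f \<in> frame_homs L N"
proof -
  have "compose (carrier L) g f (\<Squnion>\<^bsub>L\<^esub> A) = \<Squnion>\<^bsub>N\<^esub> (compose (carrier L) g f ` A)"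
    if A: "A \<subseteq> carrier L" for A
  proof -
    have "f ` A \<subseteq> carrier M"
      using A frame_homD(2)[OF assms(2)] by blast
    moreover have "compose (carrier L) g f ` A = g ` f ` A"
      using A by (force simp: compose_def)
    ultimately show ?thesis
      using A assms by (simp add: compose_def frame_sup_closed frame_homD(3))
  qed
  moreover have "compose (carrier L) g f \<in> carrier L \<rightarrow>\<^sub>E carrier N"
    using assms by (auto simp: compose_def frame_homD(2))
  ultimately show ?thesis
    using assms unfolding frame_homs_def[of L N]
    by (simp add: compose_def frame_homD frame_top_closed frame_meet_closed)
qed

lemma category_Frm: "category Frm"
proof
  fix L :: "'a gorder"
  assume "L \<in> Ob Frm"
  then have L: "frame L" by simp
  have "\<Squnion>\<^bsub>L\<^esub> ((\<lambda>x\<in>carrier L. x) ` A) = \<Squnion>\<^bsub>L\<^esub> A" if "A \<subseteq> carrier L" for A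
  proof -
    have "(\<lambda>x\<in>carrier L. x) ` A = (\<lambda>x. x) ` A"
      using that by (intro image_cong) auto
    then show ?thesis by simp
  qed
  then show "Ident Frm L \<in> Hom Frm L L"
    using L by (simp add: frame_homs_def frame_sup_closed frame_top_closed frame_meet_closed)
next
  fix L M :: "'a gorder" and f
  assume "f \<in> Hom Frm L M"
  then have "f \<in> carrier L \<rightarrow> carrier M" "f \<in> extensional (carrier L)"
    by (simp_all add: frame_homs_def PiE_def)
  then show "Comp Frm L L M f (Ident Frm L) = f" "Comp Frm L M M (Ident Frm M) f = f"
    by (simp_all add: compose_Id Id_compose)
next
  fix L1 L2 L3 L4 :: "'a gorder" and f g h
  assume "f \<in> Hom Frm L1 L2" "g \<in> Hom Frm L2 L3" "h \<in> Hom Frm L3 L4"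
  then have "f \<in> carrier L1 \<rightarrow> carrier L2"
    by (auto simp: frame_homs_def)
  then show "Comp Frm L1 L2 L4 (Comp Frm L2 L3 L4 h g) f = Comp Frm L1 L3 L4 h (Comp Frm L1 L2 L3 g f)"
    by (simp add: compose_assoc)
qed (simp add: compose_in_frame_homs)

lemma category_Loc: "category Loc"
  unfolding Loc_def by (rule category.category_op_cat[OF category_Frm])

lemma is_iso_FrmE:
  assumes "is_iso Frm L M \<phi>"
  obtains \<psi> where "is_iso Frm M L \<psi>" "\<psi> \<in> frame_homs M L"
    "\<And>x. x \<in> carrier L \<Longrightarrow> \<psi> (\<phi> x) = x" "\<And>y. y \<in> carrier M \<Longrightarrow> \<phi> (\<psi> y) = y"
proof -
  obtain \<psi> where \<psi>: "is_iso Frm M L \<psi>" "\<psi> \<in> frame_homs M L"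
    "compose (carrier L) \<psi> \<phi> = (\<lambda>x\<in>carrier L. x)" "compose (carrier M) \<phi> \<psi> = (\<lambda>x\<in>carrier M. x)"
    using assms by (rule is_isoE) simp
  have "\<psi> (\<phi> x) = x" if "x \<in> carrier L" for x
    using fun_cong[OF \<psi>(3), of x] that by (simp add: compose_def)
  moreover have "\<phi> (\<psi> y) = y" if "y \<in> carrier M" for y
    using fun_cong[OF \<psi>(4), of y] that by (simp add: compose_def)
  ultimately show thesis
    using that[OF \<psi>(1,2)] by blast
qed

lemma order_iso_of_is_iso_Frm:
  assumes "frame L" "frame M" "is_iso Frm L M \<phi>"
  shows "order_iso L M \<phi>"
proof -
  obtain \<psi> where \<psi>: "\<psi> \<in> frame_homs M L"
    "\<And>x. x \<in> carrier L \<Longrightarrow> \<psi> (\<phi> x) = x" "\<And>y. y \<in> carrier M \<Longrightarrow> \<phi> (\<psi> y) = y"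
    using assms(3) by (rule is_iso_FrmE) blast
  have \<phi>: "\<phi> \<in> frame_homs L M"
    using is_iso_in_Hom[OF assms(3)] by simp
  have "bij_betw \<phi> (carrier L) (carrier M)"
    by (rule bij_betw_byWitness[where f' = \<psi>]) (auto simp: \<psi> frame_homD(2)[OF \<phi>] frame_homD(2)[OF \<psi>(1)])
  moreover have "x \<sqsubseteq>\<^bsub>L\<^esub> y \<longleftrightarrow> \<phi> x \<sqsubseteq>\<^bsub>M\<^esub> \<phi> y" if "x \<in> carrier L" "y \<in> carrier L" for x y
    using that frame_hom_mono[OF assms(1,2) \<phi>] frame_hom_mono[OF assms(2,1) \<psi>(1)]
      frame_homD(2)[OF \<phi>] \<psi>(2) by metis
  ultimately show ?thesis
    by (simp add: order_iso_def)
qed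

text \<open>
  A family with join \<open>\<phi> l\<close> is pulled back along the inverse of \<open>\<phi>\<close>, refined in \<open>L\<close>, and the refinement
  is pushed forward along \<open>\<phi>\<close>, where it still satisfies \<open>C\<close> by invariance.
\<close>

lemma C_compact_iso:
  fixes C :: "'l family_property"
  assumes C: "invariant_family_property C"
    and LM: "frame L" "frame M" and \<phi>_iso: "is_iso Frm L M \<phi>"
    and l: "C_compact C L l"
  shows "C_compact C M (\<phi> l)"
  unfolding C_compact_def
proof (intro conjI allI ballI impI)
  have \<phi>: "\<phi> \<in> frame_homs L M"
    using is_iso_in_Hom[OF \<phi>_iso] by simp
  have lL: "l \<in> carrier L"
    using l by (simp add: C_compact_def)
  show "\<phi> l \<in> carrier M"
    using \<phi> lL frame_homD(2) by metis
  obtain \<psi> where \<psi>: "\<psi> \<in> frame_homs M L"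
    "\<And>x. x \<in> carrier L \<Longrightarrow> \<psi> (\<phi> x) = x" "\<And>y. y \<in> carrier M \<Longrightarrow> \<phi> (\<psi> y) = y"
    using \<phi>_iso by (rule is_iso_FrmE) blast
  fix I :: "'l set" and a
  assume a: "a \<in> I \<rightarrow>\<^sub>E carrier M" and sup_a: "\<Squnion>\<^bsub>M\<^esub> (a ` I) = \<phi> l"
  define a' where "a' = compose I \<psi> a"
  have aI: "a ` I \<subseteq> carrier M"
    using a by auto
  have a': "a' \<in> I \<rightarrow>\<^sub>E carrier L" "a' ` I = \<psi> ` a ` I"
    using a frame_homD(2)[OF \<psi>(1)] by (auto simp: a'_def compose_def)
  then have sup_a': "\<Squnion>\<^bsub>L\<^esub> (a' ` I) = l"
    using frame_homD(3)[OF \<psi>(1) aI] sup_a \<psi>(2)[OF lL] by simp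
  then obtain J b where b: "b \<in> J \<rightarrow>\<^sub>E carrier L" "refines L J b I a'" "C L J b"
    using l a'(1) unfolding C_compact_def has_refinement_in_def by blast
  define b' where "b' = compose J \<phi> b"
  have b': "b' \<in> J \<rightarrow>\<^sub>E carrier M" "b' ` J = \<phi> ` b ` J"
    using b(1) frame_homD(2)[OF \<phi>] by (auto simp: b'_def compose_def)
  have "\<exists>i\<in>I. b' j \<sqsubseteq>\<^bsub>M\<^esub> a i" if j: "j \<in> J" for j
  proof -
    obtain i where i: "i \<in> I" "b j \<sqsubseteq>\<^bsub>L\<^esub> a' i"
      using b(2) j unfolding refines_def by blast
    then have "\<phi> (b j) \<sqsubseteq>\<^bsub>M\<^esub> \<phi> (a' i)"
      using frame_hom_mono[OF LM \<phi>] PiE_mem[OF b(1) j] PiE_mem[OF a'(1)] by simp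
    moreover have "\<phi> (a' i) = a i"
      using \<psi>(3)[OF PiE_mem[OF a i(1)]] i(1) by (simp add: a'_def compose_def)
    ultimately show ?thesis
      using i j by (auto simp: b'_def compose_def)
  qed
  moreover have "\<Squnion>\<^bsub>M\<^esub> (b' ` J) = \<Squnion>\<^bsub>M\<^esub> (a ` I)"
  proof -
    have "\<Squnion>\<^bsub>L\<^esub> (b ` J) = l"
      using b(2) sup_a' by (simp add: refines_def)
    moreover have "b ` J \<subseteq> carrier L"
      using b(1) by auto
    ultimately show ?thesis
      using frame_homD(3)[OF \<phi>] b'(2) sup_a by metis
  qed
  moreover have "C M J b'"
    using C LM \<phi>_iso b unfolding invariant_family_property_def b'_def by blast
  ultimately show "has_refinement_in C M (carrier M) I a"
    using b'(1) unfolding has_refinement_in_def refines_def by blast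
qed

lemma order_iso_compact_poset:
  assumes C: "invariant_family_property C"
    and LM: "frame L" "frame M" and \<phi>: "is_iso Frm L M \<phi>"
  shows "order_iso (compact_poset C L) (compact_poset C M) \<phi>"
proof -
  obtain \<psi> where \<psi>_iso: "is_iso Frm M L \<psi>"
    and \<psi>: "\<And>x. x \<in> carrier L \<Longrightarrow> \<psi> (\<phi> x) = x" "\<And>y. y \<in> carrier M \<Longrightarrow> \<phi> (\<psi> y) = y"
    using \<phi> by (rule is_iso_FrmE) blast
  have closed: "l \<in> carrier L" if "C_compact C L l" for l and L :: "'a gorder"
    using that by (simp add: C_compact_def)
  have "bij_betw \<phi> {l. C_compact C L l} {m. C_compact C M m}"
    by (rule bij_betw_byWitness[where f' = \<psi>])
      (auto simp: closed \<psi> intro: C_compact_iso[OF C LM \<phi>] C_compact_iso[OF C LM(2,1) \<psi>_iso])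
  then show ?thesis
    using order_iso_of_is_iso_Frm[OF LM \<phi>]
    by (auto simp: order_iso_def compact_poset_def closed)
qed

section \<open>The frame of ideals of a site\<close>

lemma partial_order_down_mono:
  "partial_order X \<Longrightarrow> c \<in> carrier X \<Longrightarrow> d \<in> carrier X \<Longrightarrow> down X c \<subseteq> down X d \<longleftrightarrow> c \<sqsubseteq>\<^bsub>X\<^esub> d"
proof -
  assume X: "partial_order X" and cd: "c \<in> carrier X" "d \<in> carrier X"
  then interpret partial_order X by simp
  show ?thesis
    using cd le_trans by (auto simp: down_def)
qed

locale poset_site = partial_order X for X :: "'a site" (structure) +
  assumes topology: "grothendieck_topology X"
begin

lemma cover_is_sieve: "\<lbrakk>c \<in> carrier X; S \<in> covers X c\<rbrakk> \<Longrightarrow> is_sieve X c S"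
  and down_covers: "c \<in> carrier X \<Longrightarrow> down X c \<in> covers X c"
  and cover_pullback: "\<lbrakk>c \<in> carrier X; S \<in> covers X c; d \<in> down X c\<rbrakk> \<Longrightarrow> S \<inter> down X d \<in> covers X d"
  and cover_local: "\<lbrakk>c \<in> carrier X; S \<in> covers X c; is_sieve X c R;
      \<And>d. d \<in> S \<Longrightarrow> R \<inter> down X d \<in> covers X d\<rbrakk> \<Longrightarrow> R \<in> covers X c"
  using topology unfolding grothendieck_topology_def by blast+

lemma J_idealI:
  assumes "I \<subseteq> carrier X" "\<And>c d. \<lbrakk>c \<in> I; d \<in> carrier X; d \<sqsubseteq> c\<rbrakk> \<Longrightarrow> d \<in> I"
    and "\<And>c S. \<lbrakk>c \<in> carrier X; S \<in> covers X c; S \<subseteq> I\<rbrakk> \<Longrightarrow> c \<in> I"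
  shows "J_ideal X I"
  using assms unfolding J_ideal_def by blast

lemma J_ideal_subset: "J_ideal X I \<Longrightarrow> I \<subseteq> carrier X"
  and J_ideal_lower: "\<lbrakk>J_ideal X I; c \<in> I; d \<in> carrier X; d \<sqsubseteq> c\<rbrakk> \<Longrightarrow> d \<in> I"
  and J_ideal_cover: "\<lbrakk>J_ideal X I; c \<in> carrier X; S \<in> covers X c; S \<subseteq> I\<rbrakk> \<Longrightarrow> c \<in> I"
  unfolding J_ideal_def by blast+

lemma J_ideal_carrier: "J_ideal X (carrier X)"
  by (auto simp: J_ideal_def)

lemma J_ideal_Inter: "\<lbrakk>\<I> \<noteq> {}; \<And>I. I \<in> \<I> \<Longrightarrow> J_ideal X I\<rbrakk> \<Longrightarrow> J_ideal X (\<Inter>\<I>)"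
  unfolding J_ideal_def by (intro conjI; blast)

lemma ideal_gen_least: "\<lbrakk>J_ideal X I; A \<subseteq> I\<rbrakk> \<Longrightarrow> ideal_gen X A \<subseteq> I"
  and subset_ideal_gen: "A \<subseteq> ideal_gen X A"
  and ideal_gen_J_ideal: "J_ideal X I \<Longrightarrow> ideal_gen X I = I"
  by (auto simp: ideal_gen_def)

lemma ideal_gen_mono: "A \<subseteq> B \<Longrightarrow> ideal_gen X A \<subseteq> ideal_gen X B"
  unfolding ideal_gen_def by blast

lemma J_ideal_ideal_gen: "A \<subseteq> carrier X \<Longrightarrow> J_ideal X (ideal_gen X A)"
  unfolding ideal_gen_def using J_ideal_carrier by (intro J_ideal_Inter) auto

text \<open>
  The set in question is the Heyting implication \<open>I \<Rightarrow> H\<close>. It is closed under covers because covering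
  sieves can be pulled back: to test \<open>d \<le> c\<close> with \<open>d \<in> I\<close>, restrict a cover of \<open>c\<close> to \<open>d\<close>.
\<close>

lemma J_ideal_residual:
  assumes I: "\<And>c d. \<lbrakk>c \<in> I; d \<in> carrier X; d \<sqsubseteq> c\<rbrakk> \<Longrightarrow> d \<in> I" and H: "J_ideal X H"
  shows "J_ideal X {c \<in> carrier X. down X c \<inter> I \<subseteq> H}"
proof (rule J_idealI)
  fix c S
  assume c: "c \<in> carrier X" and S: "S \<in> covers X c" "S \<subseteq> {c \<in> carrier X. down X c \<inter> I \<subseteq> H}"
  have "d \<in> H" if d: "d \<in> down X c" "d \<in> I" for d
  proof (rule J_ideal_cover[OF H _ cover_pullback[OF c S(1) d(1)]])
    show "d \<in> carrier X"
      using d by (simp add: down_def)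
    show "S \<inter> down X d \<subseteq> H"
      using S(2) I d(2) by (force simp: down_def)
  qed
  then show "c \<in> {c \<in> carrier X. down X c \<inter> I \<subseteq> H}"
    using c by blast
next
  fix c d
  assume "c \<in> {c \<in> carrier X. down X c \<inter> I \<subseteq> H}" "d \<in> carrier X" "d \<sqsubseteq> c"
  then show "d \<in> {c \<in> carrier X. down X c \<inter> I \<subseteq> H}"
    using partial_order_down_mono[OF partial_order_axioms, of d c] by blast
qed auto

text \<open>
  By residuation it suffices that \<open>A\<close> is contained in the implication from \<open>B\<close> to the ideal generated
  by \<open>A \<inter> B\<close>.
\<close>

lemma ideal_gen_Int_lower:
  assumes B: "B \<subseteq> carrier X" "\<And>c d. \<lbrakk>c \<in> B; d \<in> carrier X; d \<sqsubseteq> c\<rbrakk> \<Longrightarrow> d \<in> B"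
    and A: "A \<subseteq> carrier X" "\<And>c d. \<lbrakk>c \<in> A; d \<in> carrier X; d \<sqsubseteq> c\<rbrakk> \<Longrightarrow> d \<in> A"
  shows "ideal_gen X A \<inter> B \<subseteq> ideal_gen X (A \<inter> B)"
proof -
  let ?H = "ideal_gen X (A \<inter> B)"
  have "ideal_gen X A \<subseteq> {c \<in> carrier X. down X c \<inter> B \<subseteq> ?H}"
  proof (rule ideal_gen_least[OF J_ideal_residual])
    show "J_ideal X ?H"
      using A(1) by (intro J_ideal_ideal_gen) blast
    show "A \<subseteq> {c \<in> carrier X. down X c \<inter> B \<subseteq> ?H}"
      using A subset_ideal_gen[of "A \<inter> B"] by (auto simp: down_def)
  qed (use B in blast)
  then show ?thesis
    using B(1) by (auto simp: down_def)
qed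

text \<open>
  One inclusion is \<open>ideal_gen_Int_lower\<close> applied to each side in turn. The identity yields both the
  distributivity of the frame of ideals and the preservation of meets by induced homomorphisms.
\<close>

lemma ideal_gen_Int:
  assumes A: "A \<subseteq> carrier X" "\<And>c d. \<lbrakk>c \<in> A; d \<in> carrier X; d \<sqsubseteq> c\<rbrakk> \<Longrightarrow> d \<in> A"
    and B: "B \<subseteq> carrier X" "\<And>c d. \<lbrakk>c \<in> B; d \<in> carrier X; d \<sqsubseteq> c\<rbrakk> \<Longrightarrow> d \<in> B"
  shows "ideal_gen X A \<inter> ideal_gen X B = ideal_gen X (A \<inter> B)"
proof
  have ideals: "J_ideal X (ideal_gen X A)" "J_ideal X (ideal_gen X B)" "J_ideal X (ideal_gen X (A \<inter> B))"
    using A(1) B(1) J_ideal_ideal_gen by (auto simp: le_infI1)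
  have "ideal_gen X A \<inter> ideal_gen X B \<subseteq> ideal_gen X (A \<inter> ideal_gen X B)"
    by (rule ideal_gen_Int_lower[OF J_ideal_subset[OF ideals(2)] J_ideal_lower[OF ideals(2)] A])
  also have "\<dots> \<subseteq> ideal_gen X (A \<inter> B)"
    using ideal_gen_Int_lower[OF A B] by (intro ideal_gen_least[OF ideals(3)]) (simp add: Int_commute)
  finally show "ideal_gen X A \<inter> ideal_gen X B \<subseteq> ideal_gen X (A \<inter> B)" .
  show "ideal_gen X (A \<inter> B) \<subseteq> ideal_gen X A \<inter> ideal_gen X B"
    using ideals(1,2) subset_ideal_gen[of A] subset_ideal_gen[of B]
    by (simp add: ideal_gen_least le_infI1 le_infI2)
qed

lemma carrier_ideal_frame [simp]: "I \<in> carrier (ideal_frame X) \<longleftrightarrow> J_ideal X I"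
  and le_ideal_frame [simp]: "I \<sqsubseteq>\<^bsub>ideal_frame X\<^esub> I' \<longleftrightarrow> I \<subseteq> I'"
  by (simp_all add: ideal_frame_def)

lemma partial_order_ideal_frame: "partial_order (ideal_frame X)"
  by standard (auto simp: ideal_frame_def)

lemma is_lub_ideal_frame:
  assumes "\<I> \<subseteq> carrier (ideal_frame X)"
  shows "is_lub (ideal_frame X) (ideal_gen X (\<Union>\<I>)) \<I>"
proof (rule least_UpperI)
  have ideals: "J_ideal X I" if "I \<in> \<I>" for I
    using assms that by auto
  then have "\<Union>\<I> \<subseteq> carrier X"
    using J_ideal_subset by blast
  then show "ideal_gen X (\<Union>\<I>) \<in> carrier (ideal_frame X)"
    by (simp add: J_ideal_ideal_gen)
  show "I \<sqsubseteq>\<^bsub>ideal_frame X\<^esub> ideal_gen X (\<Union>\<I>)" if "I \<in> \<I>" for I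
    using that subset_ideal_gen[of "\<Union>\<I>"] by auto
  show "ideal_gen X (\<Union>\<I>) \<sqsubseteq>\<^bsub>ideal_frame X\<^esub> I" if "I \<in> Upper (ideal_frame X) \<I>" for I
    using that ideals unfolding le_ideal_frame
    by (intro ideal_gen_least) (auto simp: Upper_def)
qed (rule assms)

lemma complete_lattice_ideal_frame: "complete_lattice (ideal_frame X)"
proof (rule partial_order.complete_latticeI[OF partial_order_ideal_frame])
  fix \<I>
  assume \<I>: "\<I> \<subseteq> carrier (ideal_frame X)"
  show "\<exists>s. is_lub (ideal_frame X) s \<I>"
    using is_lub_ideal_frame[OF \<I>] by blast
  have ideals: "J_ideal X I" if "I \<in> insert (carrier X) \<I>" for I
    using \<I> J_ideal_carrier that by auto
  \<comment> \<open>The whole poset is inserted to obtain the correct infimum of the empty family.\<close>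
  have "J_ideal X (\<Inter>(insert (carrier X) \<I>))"
    using ideals by (intro J_ideal_Inter) blast+
  then have "is_glb (ideal_frame X) (\<Inter>(insert (carrier X) \<I>)) \<I>"
    using \<I> ideals J_ideal_subset by (intro greatest_LowerI) (auto simp: Lower_def dest: subsetD)
  then show "\<exists>i. is_glb (ideal_frame X) i \<I>" ..
qed

lemma sup_ideal_frame:
  assumes "\<I> \<subseteq> carrier (ideal_frame X)"
  shows "\<Squnion>\<^bsub>ideal_frame X\<^esub> \<I> = ideal_gen X (\<Union>\<I>)"
proof -
  interpret F: complete_lattice "ideal_frame X"
    by (rule complete_lattice_ideal_frame)
  show ?thesis
    by (rule F.least_unique[OF F.sup_lub[OF assms] is_lub_ideal_frame[OF assms]])
qed

lemma meet_ideal_frame: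
  assumes "J_ideal X I" "J_ideal X I'"
  shows "I \<sqinter>\<^bsub>ideal_frame X\<^esub> I' = I \<inter> I'"
proof -
  interpret F: complete_lattice "ideal_frame X"
    by (rule complete_lattice_ideal_frame)
  have "J_ideal X (I \<inter> I')"
    using J_ideal_Inter[of "{I, I'}"] assms by auto
  then have "is_glb (ideal_frame X) (I \<inter> I') {I, I'}"
    using assms by (intro greatest_LowerI) (auto simp: Lower_def)
  then show ?thesis
    using F.greatest_unique F.inf_glb[of "{I, I'}"] assms by (simp add: meet_def)
qed

lemma top_ideal_frame: "\<top>\<^bsub>ideal_frame X\<^esub> = carrier X"
proof -
  interpret F: complete_lattice "ideal_frame X"
    by (rule complete_lattice_ideal_frame)
  show ?thesis
    using F.top_higher[of "carrier X"] F.top_closed J_ideal_carrier J_ideal_subset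
    by (intro subset_antisym) simp_all
qed

lemma frame_ideal_frame: "frame (ideal_frame X)"
  unfolding frame_def
proof (intro conjI ballI allI impI complete_lattice_ideal_frame)
  fix I \<I>
  assume I: "I \<in> carrier (ideal_frame X)" and \<I>: "\<I> \<subseteq> carrier (ideal_frame X)"
  then have \<I>_ideals: "J_ideal X J" if "J \<in> \<I>" for J
    using that by auto
  have meets: "(\<lambda>J. I \<sqinter>\<^bsub>ideal_frame X\<^esub> J) ` \<I> = (\<lambda>J. I \<inter> J) ` \<I>"
    using I \<I>_ideals by (intro image_cong) (auto simp: meet_ideal_frame)
  have "J_ideal X (I \<inter> J)" if "J \<in> \<I>" for J
    using J_ideal_Inter[of "{I, J}"] I \<I>_ideals[OF that] by auto
  then have sup: "\<Squnion>\<^bsub>ideal_frame X\<^esub> ((\<lambda>J. I \<inter> J) ` \<I>) = ideal_gen X (I \<inter> \<Union>\<I>)"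
    by (subst sup_ideal_frame) auto
  have Un: "\<Union>\<I> \<subseteq> carrier X" "\<And>c d. \<lbrakk>c \<in> \<Union>\<I>; d \<in> carrier X; d \<sqsubseteq> c\<rbrakk> \<Longrightarrow> d \<in> \<Union>\<I>"
    using \<I>_ideals J_ideal_subset J_ideal_lower by blast+
  have "I \<inter> ideal_gen X (\<Union>\<I>) = ideal_gen X (I \<inter> \<Union>\<I>)"
    using ideal_gen_Int[OF J_ideal_subset J_ideal_lower Un, of I] I by (simp add: ideal_gen_J_ideal)
  then show "I \<sqinter>\<^bsub>ideal_frame X\<^esub> (\<Squnion>\<^bsub>ideal_frame X\<^esub> \<I>) =
      \<Squnion>\<^bsub>ideal_frame X\<^esub> ((\<lambda>J. I \<sqinter>\<^bsub>ideal_frame X\<^esub> J) ` \<I>)"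
    using I \<I> Un(1) by (simp add: sup_ideal_frame meets sup meet_ideal_frame J_ideal_ideal_gen)
qed

text \<open>
  The elements \<open>d\<close> such that \<open>S\<close> restricts to a cover of \<open>d\<close> form an ideal containing \<open>S\<close>, by stability
  and the local character of covers. Hence the ideal generated by \<open>S\<close> reaches \<open>c\<close> only if \<open>S\<close>
  already covers \<open>c\<close>: the topology can be read off from its ideals.
\<close>

lemma sieve_covers_iff:
  assumes c: "c \<in> carrier X" and S: "is_sieve X c S"
  shows "S \<in> covers X c \<longleftrightarrow> c \<in> ideal_gen X S"
proof
  assume "S \<in> covers X c"
  moreover have "S \<subseteq> carrier X"
    using S by (auto simp: is_sieve_def down_def)
  ultimately show "c \<in> ideal_gen X S"
    using J_ideal_cover[OF J_ideal_ideal_gen c] subset_ideal_gen by blast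
next
  have lower: "d \<in> S" if "s \<in> S" "d \<in> carrier X" "d \<sqsubseteq> s" for s d
    using S that unfolding is_sieve_def by blast
  let ?I = "{d \<in> carrier X. S \<inter> down X d \<in> covers X d}"
  have "J_ideal X ?I"
  proof (rule J_idealI)
    fix d e
    assume d: "d \<in> ?I" and e: "e \<in> carrier X" "e \<sqsubseteq> d"
    have "S \<inter> down X d \<inter> down X e \<in> covers X e"
      using d e cover_pullback[of d "S \<inter> down X d" e] by (simp add: down_def)
    moreover have "down X e \<subseteq> down X d"
      using d e by (simp add: partial_order_down_mono[OF partial_order_axioms])
    ultimately show "e \<in> ?I"
      using e by (simp add: Int_assoc Int_absorb1)
  next
    fix e T
    assume e: "e \<in> carrier X" and T: "T \<in> covers X e" "T \<subseteq> ?I"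
    have T_down: "T \<subseteq> down X e"
      using cover_is_sieve[OF e T(1)] by (simp add: is_sieve_def)
    have "S \<inter> down X e \<in> covers X e"
    proof (rule cover_local[OF e T(1)])
      show "is_sieve X e (S \<inter> down X e)"
        using lower e le_trans by (auto simp: is_sieve_def down_def)
      fix t
      assume t: "t \<in> T"
      then have "down X t \<subseteq> down X e"
        using T_down e by (subst partial_order_down_mono[OF partial_order_axioms]) (auto simp: down_def)
      then show "S \<inter> down X e \<inter> down X t \<in> covers X t"
        using T(2) t by (auto simp: Int_assoc Int_absorb1)
    qed
    then show "e \<in> ?I"
      using e by simp
  qed auto
  moreover have "S \<subseteq> ?I"
  proof
    fix s
    assume s: "s \<in> S"
    then have "s \<in> carrier X" "S \<inter> down X s = down X s"
      using S lower by (auto simp: is_sieve_def down_def)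
    then show "s \<in> ?I"
      using down_covers by simp
  qed
  moreover assume "c \<in> ideal_gen X S"
  ultimately have "S \<inter> down X c \<in> covers X c"
    using ideal_gen_least by blast
  then show "S \<in> covers X c"
    using S by (simp add: is_sieve_def Int_absorb2)
qed

end

locale subcanonical_site = poset_site +
  assumes subcanonical: "subcanonical X"
begin

text \<open>
  A cover of \<open>d\<close> lying below \<open>c\<close> has \<open>c\<close> as an upper bound and \<open>d\<close> as its supremum, so \<open>d \<le> c\<close>.
\<close>

lemma J_ideal_down:
  assumes "c \<in> carrier X"
  shows "J_ideal X (down X c)"
proof (rule J_idealI)
  fix d S
  assume d: "d \<in> carrier X" and S: "S \<in> covers X d" "S \<subseteq> down X c"
  have "is_lub X d S"
    using subcanonical d S by (auto simp: subcanonical_def)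
  moreover have "c \<in> Upper X S"
    using S assms by (auto simp: Upper_def down_def)
  ultimately show "d \<in> down X c"
    using d by (simp add: down_def least_le)
qed (use assms le_trans in \<open>auto simp: down_def\<close>)

lemma down_image_subset: "down X ` carrier X \<subseteq> carrier (ideal_frame X)"
  using J_ideal_down by auto

lemma ideal_gen_singleton:
  assumes "c \<in> carrier X"
  shows "ideal_gen X {c} = down X c"
proof
  show "ideal_gen X {c} \<subseteq> down X c"
    using assms by (intro ideal_gen_least J_ideal_down) (auto simp: down_def)
  have "J_ideal X (ideal_gen X {c})" "c \<in> ideal_gen X {c}"
    using assms subset_ideal_gen[of "{c}"] by (auto intro: J_ideal_ideal_gen)
  then show "down X c \<subseteq> ideal_gen X {c}"
    using J_ideal_lower by (auto simp: down_def)
qed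

lemma principal_ideals_eq: "principal_ideals X = down X ` carrier X"
  by (simp add: principal_ideals_def ideal_gen_singleton cong: image_cong_simp)

lemma inj_on_down: "inj_on (down X) (carrier X)"
  by (rule inj_onI) (metis equalityD1 equalityD2 le_antisym partial_order_down_mono partial_order_axioms)

lemma ideal_gen_Union_down:
  assumes "A \<subseteq> carrier X"
  shows "ideal_gen X (\<Union>(down X ` A)) = ideal_gen X A"
proof
  have "J_ideal X (ideal_gen X A)"
    using assms by (rule J_ideal_ideal_gen)
  then show "ideal_gen X (\<Union>(down X ` A)) \<subseteq> ideal_gen X A"
    using subset_ideal_gen[of A] J_ideal_lower
    by (intro ideal_gen_least) (auto simp: down_def)
  have "A \<subseteq> \<Union>(down X ` A)"
    using assms le_refl by (fastforce simp: down_def)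
  then show "ideal_gen X A \<subseteq> ideal_gen X (\<Union>(down X ` A))"
    by (rule ideal_gen_mono)
qed

lemma sup_principal_ideals:
  assumes "A \<subseteq> carrier X"
  shows "\<Squnion>\<^bsub>ideal_frame X\<^esub> (down X ` A) = ideal_gen X A"
proof -
  have "down X ` A \<subseteq> carrier (ideal_frame X)"
    using assms J_ideal_down by auto
  then show ?thesis
    by (simp add: sup_ideal_frame ideal_gen_Union_down[OF assms])
qed

lemma J_ideal_eq_sup_principal:
  assumes "J_ideal X I"
  shows "\<Squnion>\<^bsub>ideal_frame X\<^esub> (down X ` I) = I"
  using sup_principal_ideals[OF J_ideal_subset[OF assms]] assms by (simp add: ideal_gen_J_ideal)

lemma frame_basis_principal_ideals: "frame_basis (ideal_frame X) (down X ` carrier X)"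
  unfolding frame_basis_def
proof (intro conjI ballI down_image_subset)
  fix I
  assume "I \<in> carrier (ideal_frame X)"
  then show "\<exists>S\<subseteq>down X ` carrier X. \<Squnion>\<^bsub>ideal_frame X\<^esub> S = I"
    using J_ideal_eq_sup_principal J_ideal_subset
    by (intro exI[of _ "down X ` I"]) (simp add: image_mono)
qed

lemma sup_cover:
  assumes "c \<in> carrier X" "S \<in> covers X c"
  shows "\<Squnion>\<^bsub>ideal_frame X\<^esub> (down X ` S) = down X c"
proof -
  have S: "S \<subseteq> down X c"
    using cover_is_sieve[OF assms] by (simp add: is_sieve_def)
  then have SX: "S \<subseteq> carrier X"
    by (auto simp: down_def)
  have "c \<in> ideal_gen X S"
    using assms sieve_covers_iff cover_is_sieve by blast
  then have "down X c \<subseteq> ideal_gen X S"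
    using J_ideal_lower[OF J_ideal_ideal_gen[OF SX]] by (auto simp: down_def)
  moreover have "ideal_gen X S \<subseteq> down X c"
    by (rule ideal_gen_least[OF J_ideal_down[OF assms(1)] S])
  ultimately show ?thesis
    by (simp add: sup_principal_ideals[OF SX])
qed

end

section \<open>The frame homomorphism induced by a morphism of sites\<close>

locale morphism_of_sites = X: poset_site X + Y: poset_site Y
  for X :: "'a site" and Y :: "'a site" +
  fixes f :: "'a \<Rightarrow> 'a"
  assumes morphism: "site_morphism X Y f"
begin

lemma f_closed: "c \<in> carrier X \<Longrightarrow> f c \<in> carrier Y"
  and f_mono: "\<lbrakk>c \<in> carrier X; d \<in> carrier X; c \<sqsubseteq>\<^bsub>X\<^esub> d\<rbrakk> \<Longrightarrow> f c \<sqsubseteq>\<^bsub>Y\<^esub> f d"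
  and f_cofinal: "d \<in> carrier Y \<Longrightarrow> \<exists>c \<in> carrier X. d \<sqsubseteq>\<^bsub>Y\<^esub> f c"
  and f_filtered: "\<lbrakk>d \<in> carrier Y; c \<in> carrier X; c' \<in> carrier X; d \<sqsubseteq>\<^bsub>Y\<^esub> f c; d \<sqsubseteq>\<^bsub>Y\<^esub> f c'\<rbrakk>
      \<Longrightarrow> \<exists>c'' \<in> carrier X. c'' \<sqsubseteq>\<^bsub>X\<^esub> c \<and> c'' \<sqsubseteq>\<^bsub>X\<^esub> c' \<and> d \<sqsubseteq>\<^bsub>Y\<^esub> f c''"
  and f_covers: "\<lbrakk>c \<in> carrier X; S \<in> covers X c\<rbrakk> \<Longrightarrow> generated_sieve Y (f ` S) \<in> covers Y (f c)"
  using morphism unfolding site_morphism_def isotone_def by blast+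

text \<open>
  Taking preimages is right adjoint to taking the ideal generated by the image, which reduces
  inclusions between ideals generated by images to their generators.
\<close>

lemma J_ideal_vimage:
  assumes I: "J_ideal Y I"
  shows "J_ideal X {c \<in> carrier X. f c \<in> I}"
proof (rule X.J_idealI)
  fix c S
  assume c: "c \<in> carrier X" and S: "S \<in> covers X c" "S \<subseteq> {c \<in> carrier X. f c \<in> I}"
  have "generated_sieve Y (f ` S) \<subseteq> I"
    using S(2) Y.J_ideal_lower[OF I] by (auto simp: generated_sieve_def)
  then show "c \<in> {c \<in> carrier X. f c \<in> I}"
    using c Y.J_ideal_cover[OF I f_closed[OF c] f_covers[OF c S(1)]] by simp
qed (use Y.J_ideal_lower[OF I] f_mono f_closed in auto)

lemma image_ideal_gen:
  assumes "A \<subseteq> carrier X"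
  shows "ideal_gen Y (f ` ideal_gen X A) = ideal_gen Y (f ` A)"
proof
  have closed: "J_ideal Y (ideal_gen Y (f ` A))"
    using assms f_closed by (intro Y.J_ideal_ideal_gen) auto
  have "A \<subseteq> {c \<in> carrier X. f c \<in> ideal_gen Y (f ` A)}"
    using assms Y.subset_ideal_gen[of "f ` A"] by auto
  then have "ideal_gen X A \<subseteq> {c \<in> carrier X. f c \<in> ideal_gen Y (f ` A)}"
    by (rule X.ideal_gen_least[OF J_ideal_vimage[OF closed]])
  then show "ideal_gen Y (f ` ideal_gen X A) \<subseteq> ideal_gen Y (f ` A)"
    by (intro Y.ideal_gen_least closed) auto
  show "ideal_gen Y (f ` A) \<subseteq> ideal_gen Y (f ` ideal_gen X A)"
    by (intro Y.ideal_gen_mono image_mono X.subset_ideal_gen)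
qed

lemma ideal_gen_generated_sieve:
  assumes "A \<subseteq> carrier Y"
  shows "ideal_gen Y (generated_sieve Y A) = ideal_gen Y A"
proof
  have closed: "J_ideal Y (ideal_gen Y A)"
    using assms by (rule Y.J_ideal_ideal_gen)
  then show "ideal_gen Y (generated_sieve Y A) \<subseteq> ideal_gen Y A"
    using Y.J_ideal_lower[OF closed] Y.subset_ideal_gen[of A]
    by (intro Y.ideal_gen_least closed) (auto simp: generated_sieve_def)
  have "A \<subseteq> generated_sieve Y A"
    using assms Y.le_refl unfolding generated_sieve_def by blast
  then show "ideal_gen Y A \<subseteq> ideal_gen Y (generated_sieve Y A)"
    by (rule Y.ideal_gen_mono)
qed

lemma generated_sieve_lower:
  "\<lbrakk>A \<subseteq> carrier Y; c \<in> generated_sieve Y A; d \<in> carrier Y; d \<sqsubseteq>\<^bsub>Y\<^esub> c\<rbrakk> \<Longrightarrow> d \<in> generated_sieve Y A"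
  using Y.le_trans unfolding generated_sieve_def by blast

text \<open>
  Any \<open>d\<close> below both \<open>f c\<close> and \<open>f c'\<close> is below some \<open>f c''\<close> with \<open>c'' \<le> c, c'\<close>; thus the lower sets
  generated by the images already intersect correctly, and \<open>ideal_gen_Int\<close> applies.
\<close>

lemma ideal_gen_image_Int:
  assumes I: "J_ideal X I" "J_ideal X I'"
  shows "ideal_gen Y (f ` (I \<inter> I')) = ideal_gen Y (f ` I) \<inter> ideal_gen Y (f ` I')"
proof -
  have subX: "I \<subseteq> carrier X" "I' \<subseteq> carrier X"
    using I X.J_ideal_subset by simp_all
  then have sub: "f ` I \<subseteq> carrier Y" "f ` I' \<subseteq> carrier Y" "f ` (I \<inter> I') \<subseteq> carrier Y"
    using f_closed by auto
  have "generated_sieve Y (f ` I) \<inter> generated_sieve Y (f ` I') = generated_sieve Y (f ` (I \<inter> I'))"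
  proof
    show "generated_sieve Y (f ` I) \<inter> generated_sieve Y (f ` I') \<subseteq> generated_sieve Y (f ` (I \<inter> I'))"
    proof
      fix d
      assume "d \<in> generated_sieve Y (f ` I) \<inter> generated_sieve Y (f ` I')"
      then obtain c c' where d: "d \<in> carrier Y" and c: "c \<in> I" "d \<sqsubseteq>\<^bsub>Y\<^esub> f c"
        and c': "c' \<in> I'" "d \<sqsubseteq>\<^bsub>Y\<^esub> f c'"
        by (auto simp: generated_sieve_def)
      obtain c'' where c'': "c'' \<in> carrier X" "c'' \<sqsubseteq>\<^bsub>X\<^esub> c" "c'' \<sqsubseteq>\<^bsub>X\<^esub> c'" "d \<sqsubseteq>\<^bsub>Y\<^esub> f c''"
        using f_filtered[OF d subsetD[OF subX(1) c(1)] subsetD[OF subX(2) c'(1)] c(2) c'(2)] by blast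
      then have "c'' \<in> I \<inter> I'"
        using X.J_ideal_lower[OF I(1) c(1)] X.J_ideal_lower[OF I(2) c'(1)] by simp
      then show "d \<in> generated_sieve Y (f ` (I \<inter> I'))"
        using d c''(4) by (auto simp: generated_sieve_def)
    qed
  qed (auto simp: generated_sieve_def)
  moreover have "ideal_gen Y (generated_sieve Y (f ` I) \<inter> generated_sieve Y (f ` I')) =
      ideal_gen Y (generated_sieve Y (f ` I)) \<inter> ideal_gen Y (generated_sieve Y (f ` I'))"
  proof (rule Y.ideal_gen_Int[symmetric])
    show "generated_sieve Y (f ` I) \<subseteq> carrier Y" "generated_sieve Y (f ` I') \<subseteq> carrier Y"
      by (simp_all add: generated_sieve_def)
  qed (erule (2) generated_sieve_lower[OF sub(1)], erule (2) generated_sieve_lower[OF sub(2)])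
  ultimately show ?thesis
    using sub by (simp add: ideal_gen_generated_sieve)
qed

text \<open>
  Joins are preserved because ideals can be generated before or after applying \<open>f\<close>, the top element by
  cofinality of the image of \<open>f\<close>, and meets by \<open>ideal_gen_image_Int\<close>.
\<close>

lemma ideal_map_in_frame_homs:
  "(\<lambda>I\<in>carrier (ideal_frame X). ideal_gen Y (f ` I)) \<in> frame_homs (ideal_frame X) (ideal_frame Y)"
    (is "?\<Phi> \<in> _")
proof -
  have \<Phi>: "?\<Phi> I = ideal_gen Y (f ` I)" "J_ideal Y (ideal_gen Y (f ` I))" if "J_ideal X I" for I
    using that X.J_ideal_subset[OF that] f_closed by (auto intro!: Y.J_ideal_ideal_gen)
  have "?\<Phi> (\<Squnion>\<^bsub>ideal_frame X\<^esub> \<I>) = \<Squnion>\<^bsub>ideal_frame Y\<^esub> (?\<Phi> ` \<I>)"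
    if \<I>: "\<I> \<subseteq> carrier (ideal_frame X)" for \<I>
  proof -
    have ideals: "J_ideal X I" if "I \<in> \<I>" for I
      using \<I> that by auto
    then have sub: "\<Union>\<I> \<subseteq> carrier X"
      using X.J_ideal_subset by blast
    have image: "?\<Phi> ` \<I> = (\<lambda>I. ideal_gen Y (f ` I)) ` \<I>"
      using \<Phi>(1) ideals by (intro image_cong) auto
    have closed: "J_ideal Y (ideal_gen Y (f ` \<Union>\<I>))"
      using sub f_closed by (intro Y.J_ideal_ideal_gen) auto
    have "ideal_gen Y (\<Union>I\<in>\<I>. ideal_gen Y (f ` I)) = ideal_gen Y (f ` \<Union>\<I>)"
    proof
      have "ideal_gen Y (f ` I) \<subseteq> ideal_gen Y (f ` \<Union>\<I>)" if "I \<in> \<I>" for I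
        using that by (intro Y.ideal_gen_mono) blast
      then show "ideal_gen Y (\<Union>I\<in>\<I>. ideal_gen Y (f ` I)) \<subseteq> ideal_gen Y (f ` \<Union>\<I>)"
        by (intro Y.ideal_gen_least closed) blast
      have "f ` \<Union>\<I> \<subseteq> (\<Union>I\<in>\<I>. ideal_gen Y (f ` I))"
        using Y.subset_ideal_gen by blast
      then show "ideal_gen Y (f ` \<Union>\<I>) \<subseteq> ideal_gen Y (\<Union>I\<in>\<I>. ideal_gen Y (f ` I))"
        by (rule Y.ideal_gen_mono)
    qed
    moreover have "(\<lambda>I. ideal_gen Y (f ` I)) ` \<I> \<subseteq> carrier (ideal_frame Y)"
      using \<Phi>(2) ideals by auto
    ultimately show ?thesis
      using \<Phi>(1)[OF X.J_ideal_ideal_gen[OF sub]] image_ideal_gen[OF sub] unfolding image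
      by (simp add: X.sup_ideal_frame[OF \<I>] Y.sup_ideal_frame)
  qed
  moreover have "?\<Phi> \<top>\<^bsub>ideal_frame X\<^esub> = \<top>\<^bsub>ideal_frame Y\<^esub>"
  proof -
    have "carrier Y \<subseteq> ideal_gen Y (f ` carrier X)"
      using f_cofinal Y.subset_ideal_gen[of "f ` carrier X"]
        Y.J_ideal_lower[OF \<Phi>(2)[OF X.J_ideal_carrier]] by blast
    then show ?thesis
      using Y.J_ideal_subset[OF \<Phi>(2)[OF X.J_ideal_carrier]] X.J_ideal_carrier
      by (auto simp: X.top_ideal_frame Y.top_ideal_frame)
  qed
  moreover have "?\<Phi> (I \<sqinter>\<^bsub>ideal_frame X\<^esub> I') = ?\<Phi> I \<sqinter>\<^bsub>ideal_frame Y\<^esub> ?\<Phi> I'"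
    if "J_ideal X I" "J_ideal X I'" for I I'
  proof -
    have "J_ideal X (I \<inter> I')"
      using X.J_ideal_Inter[of "{I, I'}"] that by auto
    then show ?thesis
      using that \<Phi> by (simp add: X.meet_ideal_frame Y.meet_ideal_frame ideal_gen_image_Int)
  qed
  moreover have "?\<Phi> \<in> carrier (ideal_frame X) \<rightarrow>\<^sub>E carrier (ideal_frame Y)"
    using \<Phi> by simp
  ultimately show ?thesis
    by (simp add: frame_homs_def)
qed

end

section \<open>Compact elements of the frame of ideals\<close>

context subcanonical_site
begin

text \<open>
  The defining equivalence of a \<open>C\<close>-induced topology for the canonical embedding into the frame of
  ideals, freed of the auxiliary property of bases.
\<close>

definition topology_detected_by :: "'a set family_property \<Rightarrow> bool" where
  "topology_detected_by C \<longleftrightarrow>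
     (\<forall>I. \<forall>a \<in> I \<rightarrow>\<^sub>E carrier X.
        (\<exists>c \<in> carrier X. (\<forall>k \<in> I. a k \<sqsubseteq> c) \<and> generated_sieve X (a ` I) \<in> covers X c) \<longleftrightarrow>
        has_refinement_in C (ideal_frame X) (down X ` carrier X) I (compose I (down X) a))"

lemma C_induced_imp_detected:
  assumes "C_induced K C X" "X \<in> Ob K"
  shows "topology_detected_by C"
proof -
  obtain P where P: "\<forall>Y \<in> Ob K. P (ideal_frame Y) (down Y ` carrier Y)" "C_induced_relative C P X"
    using assms(1) unfolding C_induced_def by blast
  have "down X \<in> carrier X \<rightarrow> carrier (ideal_frame X)"
    using J_ideal_down by simp
  moreover have "\<forall>c \<in> carrier X. \<forall>d \<in> carrier X. c \<sqsubseteq> d \<longleftrightarrow> down X c \<sqsubseteq>\<^bsub>ideal_frame X\<^esub> down X d"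
    by (simp add: partial_order_down_mono[OF partial_order_axioms])
  moreover have "\<forall>c \<in> carrier X. \<forall>S \<in> covers X c. down X c = \<Squnion>\<^bsub>ideal_frame X\<^esub> (down X ` S)"
    using sup_cover by simp
  moreover have "P (ideal_frame X) (down X ` carrier X)"
    using P(1) assms(2) by blast
  ultimately show ?thesis
    using P(2) frame_ideal_frame frame_basis_principal_ideals
    unfolding C_induced_relative_def topology_detected_by_def by blast
qed

text \<open>
  A \<open>C\<close>-compact ideal \<open>l\<close> is the join of the principal ideals of its elements. A \<open>C\<close>-refinement of this
  family can be taken principal, so the elements of \<open>l\<close> generate a covering sieve on some \<open>c\<close>. As \<open>l\<close>
  is an ideal, \<open>c\<close> belongs to it and is its greatest element.
\<close>

lemma C_compact_ideal_imp_principal: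
  assumes detected: "topology_detected_by C"
    and restrict: "\<And>I a. a \<in> I \<rightarrow>\<^sub>E principal_ideals X \<Longrightarrow>
      has_refinement_in C (ideal_frame X) (carrier (ideal_frame X)) I a \<Longrightarrow>
      has_refinement_in C (ideal_frame X) (principal_ideals X) I a"
    and l: "C_compact C (ideal_frame X) l"
  shows "l \<in> down X ` carrier X"
proof -
  have ideal: "J_ideal X l"
    using l by (simp add: C_compact_def)
  \<comment> \<open>Indices are subsets of the poset, so an element is indexed by its singleton.\<close>
  define I where "I = (\<lambda>c. {c}) ` l"
  define a where "a = (\<lambda>s\<in>I. the_elem s)"
  have a: "a \<in> I \<rightarrow>\<^sub>E carrier X" and aI: "a ` I = l"
    using J_ideal_subset[OF ideal] by (auto simp: a_def I_def image_image)
  let ?i = "compose I (down X) a"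
  have i: "?i \<in> I \<rightarrow>\<^sub>E principal_ideals X" "?i ` I = down X ` l"
    using a aI by (auto simp: compose_def principal_ideals_eq)
  have "?i \<in> I \<rightarrow>\<^sub>E carrier (ideal_frame X)"
    using i(1) down_image_subset unfolding principal_ideals_eq PiE_iff by blast
  moreover have "\<Squnion>\<^bsub>ideal_frame X\<^esub> (?i ` I) = l"
    using i(2) J_ideal_eq_sup_principal[OF ideal] by simp
  ultimately have "has_refinement_in C (ideal_frame X) (carrier (ideal_frame X)) I ?i"
    using l unfolding C_compact_def by blast
  then have "has_refinement_in C (ideal_frame X) (down X ` carrier X) I ?i"
    using restrict[OF i(1)] by (simp add: principal_ideals_eq)
  then obtain c where c: "c \<in> carrier X" "\<forall>k \<in> I. a k \<sqsubseteq> c" "generated_sieve X (a ` I) \<in> covers X c"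
    using detected a unfolding topology_detected_by_def by blast
  have "generated_sieve X (a ` I) \<subseteq> l"
    using J_ideal_lower[OF ideal] by (auto simp: generated_sieve_def aI)
  then have "c \<in> l"
    by (rule J_ideal_cover[OF ideal c(1,3)])
  moreover have "d \<sqsubseteq> c" if "d \<in> l" for d
    using c(2) that aI by force
  ultimately have "l = down X c"
    using J_ideal_subset[OF ideal] J_ideal_lower[OF ideal] by (auto simp: down_def)
  then show ?thesis
    using c(1) by blast
qed

text \<open>
  If ideals have join \<open>down X c\<close>, their union is a sieve that generates an ideal containing \<open>c\<close>, hence
  a covering sieve. A \<open>C\<close>-refinement of the principal ideals of its elements refines the given
  ideals as well, since each such principal ideal is contained in one of them.
\<close>

lemma C_compact_down:
  assumes detected: "topology_detected_by C" and c: "c \<in> carrier X"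
  shows "C_compact C (ideal_frame X) (down X c)"
  unfolding C_compact_def
proof (intro conjI allI ballI impI)
  show "down X c \<in> carrier (ideal_frame X)"
    using J_ideal_down[OF c] by simp
  fix I :: "'a set set" and a
  assume a: "a \<in> I \<rightarrow>\<^sub>E carrier (ideal_frame X)" and sup_a: "\<Squnion>\<^bsub>ideal_frame X\<^esub> (a ` I) = down X c"
  define S where "S = \<Union>(a ` I)"
  have ideals: "J_ideal X (a k)" if "k \<in> I" for k
    using PiE_mem[OF a that] by simp
  have gen_S: "ideal_gen X S = down X c"
    using a sup_a by (subst (asm) sup_ideal_frame) (auto simp: S_def)
  have lower: "d \<in> S" if "s \<in> S" "d \<in> carrier X" "d \<sqsubseteq> s" for s d
    using that ideals J_ideal_lower unfolding S_def by blast
  have sieve: "is_sieve X c S"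
    using gen_S subset_ideal_gen[of S] lower by (auto simp: is_sieve_def)
  have SX: "S \<subseteq> carrier X"
    using sieve by (auto simp: is_sieve_def down_def)
  have S_covers: "S \<in> covers X c"
    using sieve_covers_iff[OF c sieve] gen_S c by (simp add: down_def)
  \<comment> \<open>The elements of the sieve form a family indexed by their singletons.\<close>
  define I' where "I' = (\<lambda>s. {s}) ` S"
  define e where "e = (\<lambda>s\<in>I'. the_elem s)"
  have e: "e \<in> I' \<rightarrow>\<^sub>E carrier X" and eI': "e ` I' = S"
    using SX by (auto simp: e_def I'_def image_image)
  have "generated_sieve X S \<subseteq> S"
    using sieve unfolding generated_sieve_def is_sieve_def by blast
  moreover have "S \<subseteq> generated_sieve X S"
    using SX le_refl unfolding generated_sieve_def by blast
  ultimately have "generated_sieve X (e ` I') = S"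
    by (simp add: eI')
  moreover have "\<forall>k \<in> I'. e k \<sqsubseteq> c"
    using eI' sieve by (auto simp: is_sieve_def down_def)
  ultimately have "(\<forall>k \<in> I'. e k \<sqsubseteq> c) \<and> generated_sieve X (e ` I') \<in> covers X c"
    using S_covers by simp
  then have "has_refinement_in C (ideal_frame X) (down X ` carrier X) I' (compose I' (down X) e)"
    using detected e c unfolding topology_detected_by_def by blast
  then obtain J b where b: "b \<in> J \<rightarrow>\<^sub>E down X ` carrier X"
    "refines (ideal_frame X) J b I' (compose I' (down X) e)" "C (ideal_frame X) J b"
    unfolding has_refinement_in_def by blast
  have image: "compose I' (down X) e ` I' = down X ` S"
    using eI' by (auto simp: compose_def)
  have "\<exists>i\<in>I. b j \<subseteq> a i" if j: "j \<in> J" for j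
  proof -
    obtain k where "k \<in> I'" "b j \<subseteq> compose I' (down X) e k"
      using b(2) j by (auto simp: refines_def)
    then obtain s where s: "s \<in> S" "b j \<subseteq> down X s"
      using eI' by (auto simp: compose_def)
    then obtain i where i: "i \<in> I" "s \<in> a i"
      by (auto simp: S_def)
    then have "down X s \<subseteq> a i"
      using J_ideal_lower[OF ideals[OF i(1)] i(2)] by (auto simp: down_def)
    then show ?thesis
      using s i by blast
  qed
  moreover have "\<Squnion>\<^bsub>ideal_frame X\<^esub> (b ` J) = \<Squnion>\<^bsub>ideal_frame X\<^esub> (a ` I)"
    using b(2) unfolding refines_def image sup_principal_ideals[OF SX] gen_S sup_a by simp
  moreover have "b \<in> J \<rightarrow>\<^sub>E carrier (ideal_frame X)"
    using b(1) down_image_subset unfolding PiE_iff by blast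
  ultimately show "has_refinement_in C (ideal_frame X) (carrier (ideal_frame X)) I a"
    using b(3) unfolding has_refinement_in_def refines_def le_ideal_frame by blast
qed

lemma order_iso_down_compact:
  assumes "topology_detected_by C"
    and "\<And>I a. a \<in> I \<rightarrow>\<^sub>E principal_ideals X \<Longrightarrow>
      has_refinement_in C (ideal_frame X) (carrier (ideal_frame X)) I a \<Longrightarrow>
      has_refinement_in C (ideal_frame X) (principal_ideals X) I a"
  shows "order_iso X (compact_poset C (ideal_frame X)) (down X)"
proof -
  have "{l. C_compact C (ideal_frame X) l} = down X ` carrier X"
    using C_compact_ideal_imp_principal[OF assms] C_compact_down[OF assms(1)] by blast
  then show ?thesis
    using inj_on_down
    by (simp add: order_iso_def compact_poset_def bij_betw_def
        partial_order_down_mono[OF partial_order_axioms])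
qed

end

lemma order_iso_comp:
  assumes "order_iso P Q f" "order_iso Q R g"
  shows "order_iso P R (g \<circ> f)"
proof -
  have "f x \<in> carrier Q" if "x \<in> carrier P" for x
    using that assms(1) by (auto simp: order_iso_def bij_betw_def)
  then show ?thesis
    using assms bij_betw_trans[of f "carrier P" "carrier Q" g "carrier R"]
    by (simp add: order_iso_def)
qed

section \<open>The duality\<close>

lemma Loc_simps [simp]:
  "Ob Loc = {L. frame L}" "Hom Loc L M = frame_homs M L" "Ident Loc L = (\<lambda>x\<in>carrier L. x)"
  "Comp Loc L M N g f = compose (carrier N) f g"
  by (simp_all add: Loc_def)

lemma ideal_functor_simps [simp]:
  "on_ob ideal_functor X = ideal_frame X"
  "on_arr ideal_functor X Y f = (\<lambda>I\<in>carrier (ideal_frame Y). ideal_gen X (f ` I))"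
  by (simp_all add: ideal_functor_def)

locale category_of_sites =
  fixes K :: "('a site, 'a \<Rightarrow> 'a) cat"
  assumes site_category: "site_category K"
begin

lemma category_K: "category K"
  and Ident_K: "X \<in> Ob K \<Longrightarrow> Ident K X = (\<lambda>x\<in>carrier X. x)"
  and Comp_K: "\<lbrakk>X \<in> Ob K; Y \<in> Ob K; Z \<in> Ob K; f \<in> Hom K X Y; g \<in> Hom K Y Z\<rbrakk>
      \<Longrightarrow> Comp K X Y Z g f = compose (carrier X) g f"
  and Hom_K_extensional: "\<lbrakk>X \<in> Ob K; Y \<in> Ob K; f \<in> Hom K X Y\<rbrakk> \<Longrightarrow> f \<in> extensional (carrier X)"
  using site_category unfolding site_category_def by blast+

lemma subcanonical_site_K: "X \<in> Ob K \<Longrightarrow> subcanonical_site X"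
  using site_category
  by (simp add: site_category_def subcanonical_site_def poset_site_def
      subcanonical_site_axioms_def poset_site_axioms_def)

lemma morphism_of_sites_K: "\<lbrakk>X \<in> Ob K; Y \<in> Ob K; f \<in> Hom K X Y\<rbrakk> \<Longrightarrow> morphism_of_sites X Y f"
  using site_category subcanonical_site_K
  by (simp add: site_category_def subcanonical_site_def morphism_of_sites_def
      morphism_of_sites_axioms_def)

text \<open>
  Both sides are generated by the single element \<open>f c\<close>.
\<close>

lemma ideal_gen_image_down:
  assumes "X \<in> Ob K" "Y \<in> Ob K" "f \<in> Hom K X Y" "c \<in> carrier X"
  shows "ideal_gen Y (f ` down X c) = down Y (f c)"
proof -
  interpret f: morphism_of_sites X Y f
    using assms by (simp add: morphism_of_sites_K)
  show ?thesis
    using f.image_ideal_gen[of "{c}"] f.f_closed assms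
      subcanonical_site.ideal_gen_singleton[OF subcanonical_site_K] by simp
qed

lemma on_arr_ideal_functor_down:
  assumes "X \<in> Ob K" "Y \<in> Ob K" "f \<in> Hom K Y X" "c \<in> carrier Y"
  shows "on_arr ideal_functor X Y f (down Y c) = down X (f c)"
proof -
  interpret Y: subcanonical_site Y
    using assms by (simp add: subcanonical_site_K)
  show ?thesis
    using assms Y.J_ideal_down by (simp add: ideal_gen_image_down)
qed

lemma ideal_functor_is_functor: "is_functor (op_cat K) Loc ideal_functor"
  unfolding is_functor_def
proof (intro conjI ballI)
  show "category (op_cat K)" "category Loc"
    by (simp_all add: category.category_op_cat category_K category_Loc)
next
  fix X
  assume X: "X \<in> Ob (op_cat K)"
  then interpret subcanonical_site X
    by (simp add: subcanonical_site_K)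
  show "on_ob ideal_functor X \<in> Ob Loc"
    by (simp add: frame_ideal_frame)
  have "(\<lambda>x\<in>carrier X. x) ` I = I" if "J_ideal X I" for I
    using J_ideal_subset[OF that] by auto
  then show "on_arr ideal_functor X X (Ident (op_cat K) X) = Ident Loc (on_ob ideal_functor X)"
    using X by (auto simp: Ident_K ideal_gen_J_ideal intro: restrict_ext)
next
  fix X Y f
  assume "X \<in> Ob (op_cat K)" "Y \<in> Ob (op_cat K)" "f \<in> Hom (op_cat K) X Y"
  then interpret morphism_of_sites Y X f
    by (simp add: morphism_of_sites_K)
  show "on_arr ideal_functor X Y f \<in> Hom Loc (on_ob ideal_functor X) (on_ob ideal_functor Y)"
    using ideal_map_in_frame_homs by simp
next
  fix X Y Z f g
  assume ob: "X \<in> Ob (op_cat K)" "Y \<in> Ob (op_cat K)" "Z \<in> Ob (op_cat K)"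
    and f: "f \<in> Hom (op_cat K) X Y" and g: "g \<in> Hom (op_cat K) Y Z"
  interpret f: morphism_of_sites Y X f
    using ob f by (simp add: morphism_of_sites_K)
  interpret g: morphism_of_sites Z Y g
    using ob g by (simp add: morphism_of_sites_K)
  have "ideal_gen X (compose (carrier Z) f g ` I) = ideal_gen X (f ` ideal_gen Y (g ` I))"
    and "J_ideal Y (ideal_gen Y (g ` I))" if "J_ideal Z I" for I
  proof -
    have I: "I \<subseteq> carrier Z" "g ` I \<subseteq> carrier Y"
      using g.X.J_ideal_subset[OF that] g.f_closed by auto
    have "compose (carrier Z) f g ` I = f ` g ` I"
      unfolding image_image using I(1) by (intro image_cong) (auto simp: compose_def)
    then show "ideal_gen X (compose (carrier Z) f g ` I) = ideal_gen X (f ` ideal_gen Y (g ` I))"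
      by (simp add: f.image_ideal_gen[OF I(2)])
    show "J_ideal Y (ideal_gen Y (g ` I))"
      using I(2) by (rule f.X.J_ideal_ideal_gen)
  qed
  then show "on_arr ideal_functor X Z (Comp (op_cat K) X Y Z g f) =
      Comp Loc (on_ob ideal_functor X) (on_ob ideal_functor Y) (on_ob ideal_functor Z)
        (on_arr ideal_functor Y Z g) (on_arr ideal_functor X Y f)"
    using ob f g by (auto simp: Comp_K compose_def[of "carrier (ideal_frame Z)"] intro: restrict_ext)
qed

lemma ideal_functor_faithful:
  assumes ob: "X \<in> Ob K" "Y \<in> Ob K" and uv: "u \<in> Hom K Y X" "v \<in> Hom K Y X"
    and eq: "on_arr ideal_functor X Y u = on_arr ideal_functor X Y v"
  shows "u = v"
proof (rule extensionalityI)
  show "u \<in> extensional (carrier Y)" "v \<in> extensional (carrier Y)"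
    using Hom_K_extensional ob uv by blast+
  interpret X: subcanonical_site X
    using ob by (simp add: subcanonical_site_K)
  fix c
  assume c: "c \<in> carrier Y"
  have "down X (u c) = down X (v c)"
    using on_arr_ideal_functor_down[OF ob uv(1) c] on_arr_ideal_functor_down[OF ob uv(2) c] eq by metis
  moreover have "u c \<in> carrier X" "v c \<in> carrier X"
    using morphism_of_sites.f_closed[OF morphism_of_sites_K] ob uv c by blast+
  ultimately show "u c = v c"
    using X.inj_on_down by (simp add: inj_on_eq_iff)
qed

end

theorem theorem3p27:
  fixes K :: "('a site, 'a \<Rightarrow> 'a) cat"
    and C :: "'a set family_property"
  assumes "site_category K"
    and "creates_isos (op_cat K) Loc ideal_functor"
    and "invariant_family_property C"
    and "\<And>X I a. \<lbrakk>X \<in> Ob K; a \<in> I \<rightarrow>\<^sub>E principal_ideals X\<rbrakk> \<Longrightarrow>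
      has_refinement_in C (ideal_frame X) (carrier (ideal_frame X)) I a \<longleftrightarrow>
      has_refinement_in C (ideal_frame X) (principal_ideals X) I a"
    and "\<And>X. X \<in> Ob K \<Longrightarrow> C_induced K C X"
  shows "\<exists>I_A. categorical_inverse (op_cat K) (ExtIm (op_cat K) Loc ideal_functor) ideal_functor I_A \<and>
    given_by_compact_elements C (ExtIm (op_cat K) Loc ideal_functor) I_A"
proof -
  interpret category_of_sites K
    by standard (rule assms(1))
  interpret A: iso_creating_functor "op_cat K" Loc ideal_functor
    by standard (rule ideal_functor_is_functor, rule assms(2))
  have faithful: "u = v" if "X \<in> Ob (op_cat K)" "Y \<in> Ob (op_cat K)" "u \<in> Hom (op_cat K) X Y"
    "v \<in> Hom (op_cat K) X Y" "on_arr ideal_functor X Y u = on_arr ideal_functor X Y v" for X Y u v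
    using that unfolding op_cat_simps by (rule ideal_functor_faithful)
  obtain G \<alpha> where inverse: "categorical_inverse (op_cat K) A.\<E> ideal_functor G"
    and \<alpha>: "\<And>L. L \<in> Ob A.\<E> \<Longrightarrow> is_iso Loc L (on_ob ideal_functor (on_ob G L)) (\<alpha> L)"
    and natural: "\<And>L L' f. \<lbrakk>L \<in> Ob A.\<E>; L' \<in> Ob A.\<E>; f \<in> Hom A.\<E> L L'\<rbrakk> \<Longrightarrow>
      Comp Loc L (on_ob ideal_functor (on_ob G L)) (on_ob ideal_functor (on_ob G L'))
        (on_arr ideal_functor (on_ob G L) (on_ob G L') (on_arr G L L' f)) (\<alpha> L) =
      Comp Loc L L' (on_ob ideal_functor (on_ob G L')) (\<alpha> L') f"
    by (rule A.faithful_imp_categorical_inverse[OF faithful]) blast+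
  have G_ob: "on_ob G L \<in> Ob K" if "L \<in> Ob A.\<E>" for L
    using inverse that by (simp add: categorical_inverse_def is_functor_def)
  have G_arr: "on_arr G L L' f \<in> Hom K (on_ob G L') (on_ob G L)"
    if "L \<in> Ob A.\<E>" "L' \<in> Ob A.\<E>" "f \<in> Hom A.\<E> L L'" for L L' f
    using inverse that by (simp add: categorical_inverse_def is_functor_def)
  have frame: "frame L" if "L \<in> Ob A.\<E>" for L
    using that by (simp add: A.ExtIm_simps)
  \<comment> \<open>Elements of \<open>G L\<close> are sent to principal ideals and then along the chosen presentation of \<open>L\<close>.\<close>
  define \<phi> where "\<phi> L = \<alpha> L \<circ> down (on_ob G L)" for L
  have \<phi>: "order_iso (on_ob G L) (compact_poset C L) (\<phi> L)" if L: "L \<in> Ob A.\<E>" for L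
  proof -
    interpret subcanonical_site "on_ob G L"
      using G_ob[OF L] by (rule subcanonical_site_K)
    have "order_iso (on_ob G L) (compact_poset C (ideal_frame (on_ob G L))) (down (on_ob G L))"
    proof (rule order_iso_down_compact)
      show "topology_detected_by C"
        by (rule C_induced_imp_detected[OF assms(5)[OF G_ob[OF L]] G_ob[OF L]])
    qed (simp only: assms(4)[OF G_ob[OF L]])
    moreover have "order_iso (compact_poset C (ideal_frame (on_ob G L))) (compact_poset C L) (\<alpha> L)"
      using \<alpha>[OF L] unfolding Loc_def is_iso_op_cat ideal_functor_simps
      by (rule order_iso_compact_poset[OF assms(3) frame_ideal_frame frame[OF L]])
    ultimately show ?thesis
      unfolding \<phi>_def by (rule order_iso_comp)
  qed
  have \<phi>_natural: "\<phi> L (on_arr G L L' f x) = f (\<phi> L' x)"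
    if L: "L \<in> Ob A.\<E>" "L' \<in> Ob A.\<E>" and f: "f \<in> Hom A.\<E> L L'" and x: "x \<in> carrier (on_ob G L')"
    for L L' f x
  proof -
    interpret subcanonical_site "on_ob G L'"
      using G_ob[OF L(2)] by (rule subcanonical_site_K)
    show ?thesis
      using fun_cong[OF natural[OF L f], of "down (on_ob G L') x"] J_ideal_down[OF x]
        on_arr_ideal_functor_down[OF G_ob[OF L(1)] G_ob[OF L(2)] G_arr[OF L f] x]
      by (simp add: \<phi>_def compose_def del: ideal_functor_simps(2))
  qed
  have "f ` carrier (compact_poset C L') \<subseteq> carrier (compact_poset C L)"
    if L: "L \<in> Ob A.\<E>" "L' \<in> Ob A.\<E>" and f: "f \<in> Hom A.\<E> L L'" for L L' f
  proof -
    \<comment> \<open>Compact elements of \<open>L'\<close> are of the form \<open>\<phi> L' x\<close>, so naturality determines their images.\<close>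
    have image: "carrier (compact_poset C M) = \<phi> M ` carrier (on_ob G M)" if "M \<in> Ob A.\<E>" for M
      using \<phi>[OF that] by (simp add: order_iso_def bij_betw_def)
    have "on_arr G L L' f x \<in> carrier (on_ob G L)" if "x \<in> carrier (on_ob G L')" for x
      using morphism_of_sites.f_closed[OF morphism_of_sites_K] G_ob L G_arr[OF L f] that by blast
    then have "f (\<phi> L' x) \<in> \<phi> L ` carrier (on_ob G L)" if "x \<in> carrier (on_ob G L')" for x
      using that by (subst \<phi>_natural[OF L f that, symmetric]) (rule imageI)
    then show ?thesis
      unfolding image[OF L(1)] image[OF L(2)] by (simp add: image_subset_iff)
  qed
  then have "given_by_compact_elements C A.\<E> G"
    unfolding given_by_compact_elements_def using \<phi> \<phi>_natural
    by (intro exI[of _ \<phi>] conjI ballI) simp_all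
  then show ?thesis
    using inverse by blast
qed

end
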